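(* Let $d\ge 2$, $N\ge1$ and $r\ge 1$ be integers, let $\alpha>0$, and let $f:\mathbb{R}\to[0,1]$ be a monotone differentiable function such that $f$ and $f'$ are non-zero on $[-\alpha,\alpha]$ and the quantities $$L_\alpha=\sup_{|x|\le\alpha}\frac{|f'(x)|}{f(x)(1-f(x))},\qquad \beta_\alpha=\sup_{|x|\le\alpha}\frac{f(x)(1-f(x))}{(f'(x))^2},\qquad U_\alpha=\sup_{|x|\le\alpha}\log\Big(\frac{1}{f(x)(1-f(x))}\Big)$$ are well defined (finite). Let $T^\sharp_r\in\mathbb{R}^{N^d}$ be a rank-$r$ tensor with $\|T^\sharp_r\|_\infty\le\alpha$. Suppose $m$ 1-bit measurements of entries of $T^\sharp_r$, with $2\le m\le N^d$, are acquired according to the observation model described in the context, with sampling distribution $\Pi=\{\pi_\omega\}_{\omega\in[N]^d}$, and let $\mathcal{L}_{\Omega,Y}$ be the associated negative log-likelihood. There exist absolute constants $C_{\max}$ and $C_M$ such that the following hold for every $0<\delta<1$. (i) $\|T^\sharp_r\|_{\max}\le\sqrt{r^{d^2-d}}\,\alpha$, and the minimizer $\hat T_{\max}$ of $\mathcal{L}_{\Omega,Y}(X)$ over $X\in K^T_{\max}(\alpha,R_{\max})$ with $R_{\max}=\sqrt{r^{d^2-d}}\,\alpha$ satisfies, with probability at least $1-\delta$, $$\|T^\sharp_r-\hat T_{\max}\|_\Pi^2\le C_{\max}\,c_2^d\,\beta_\alpha\Big\{L_\alpha\sqrt{r^{d^2-d}}\,\alpha\sqrt{\frac{dN}{m}}+U_\alpha\sqrt{\frac{\log(4/\delta)}{m}}\Big\}.$$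 (ii) $\|T^\sharp_r\|_{M}\le(r\sqrt r)^{d-1}\alpha$, and the minimizer $\hat T_{M}$ of $\mathcal{L}_{\Omega,Y}(X)$ over $X\in K^T_{M}(\alpha,R_{M})$ with $R_{M}=(r\sqrt r)^{d-1}\alpha$ satisfies, with probability at least $1-\delta$, $$\|T^\sharp_r-\hat T_{M}\|_\Pi^2\le C_{M}\,\beta_\alpha\Big\{L_\alpha(r\sqrt r)^{d-1}\alpha\sqrt{\frac{dN}{m}}+U_\alpha\sqrt{\frac{\log(4/\delta)}{m}}\Big\}.$$ Here "absolute" means that $C_{\max},C_M$ do not depend on $N,d,r,m,\alpha,f,\Pi,T^\sharp_r,\delta$, and $c_2$ is the fixed numerical constant described in the context.
   Context: Notation. $[N]=\{1,\dots,N\}$; $\mathbb{R}^{N^d}$ denotes order-$d$ tensors with all dimensions equal to $N$; entries are written $T_\omega$ or $T(\omega)$ for $\omega=(i_1,\dots,i_d)\in[N]^d$; $\|T\|_\infty=\max_\omega|T_\omega|$; for a probability distribution $\Pi=\{\pi_\omega\}$ on $[N]^d$, $\|T\|_\Pi^2=\sum_\omega\pi_\omega T(\omega)^2$. A rank-one tensor is a nonzero outer product $u^{(1)}\circ\cdots\circ u^{(d)}$ of $d$ vectors; the rank of $T$ is the least number of rank-one tensors summing to $T$ (CP rank). Max-qnorm. For matrices $U^{(j)}\in\mathbb{R}^{N\times k}$, $j=1,\dots,d$ (with a common, arbitrary number $k$ of columns), $U^{(1)}\circ\cdots\circ U^{(d)}$ is the tensor with entries $\sum_{l=1}^k U^{(1)}(i_1,l)\cdots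 U^{(d)}(i_d,l)$. $\|U\|_{2,\infty}$ is the maximum Euclidean norm of a row of $U$. Define $$\|T\|_{\max}=\min\Big\{\prod_{j=1}^d\|U^{(j)}\|_{2,\infty}: T=U^{(1)}\circ\cdots\circ U^{(d)}\Big\}.$$ M-norm. Let $T_\pm$ be the set of rank-one tensors with all entries in $\{\pm1\}$. Define $\|T\|_M=\inf\{t>0: T\in t\,\mathrm{conv}(T_\pm)\}$. Constraint sets. $K^T_{\max}(\alpha,R)=\{T:\|T\|_\infty\le\alpha,\ \|T\|_{\max}\le R\}$ and $K^T_{M}(\alpha,R)=\{T:\|T\|_\infty\le\alpha,\ \|T\|_{M}\le R\}$. Constants. $c_1,c_2$ are fixed numerical constants coming from the generalized Grothendieck theorem, such that $\|T\|_M\le c_1c_2^d\|T\|_{\max}$ for every order-$d$ tensor $T$. Observation model. $\Pi=\{\pi_\omega\}_{\omega\in[N]^d}$ is a probability distribution on the indices. Indices $\omega_1,\dots,\omega_m$ are drawn independently from $\Pi$ (with replacement; $\Omega$ denotes the resulting collection counted with multiplicity). For each sampled index a bit is observed, independently across samples given the indices: the bit $Y_{\omega_i}$ equals $+1$ with probability $f(T^\sharp_r(\omega_i))$ and $-1$ with probability $1-f(T^\sharp_r(\omega_i))$. Negative log-likelihood. $$\mathcal{L}_{\Omega,Y}(X)=\sum_{\omega\in\Omega}\Big(\mathbf{1}_{[Y_\omega=1]}\log\frac1{f(X_\omega)}+\mathbf{1}_{[Y_\omega=-1]}\log\frac1{1-f(X_\omega)}\Big),$$ the sum running over the $m$ samples.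 "The minimizer" means any minimizer of the constrained problem. *)

theory Defs
  imports "HOL-Probability.Probability" "HOL-Library.Function_Algebras"
begin

instantiation "fun" :: (type, real_vector) real_vector
begin

definition scaleR_fun_def: "c *\<^sub>R f = (\<lambda>x. c *\<^sub>R f x)"

instance
  by standard (auto simp: scaleR_fun_def fun_eq_iff scaleR_add_right scaleR_add_left)

end

section \<open>Tensors\<close>

text \<open>
  The order \<open>d\<close> and the dimension \<open>N\<close> are quantified inside the final statement, so a tensor is a
  real function on multi-indices \<open>\<omega>\<close> with \<open>\<omega> j = i\<^sub>j\<close>, which vanishes outside the index set.
\<close>

type_synonym index = "nat \<Rightarrow> nat"
type_synonym tensor = "index \<Rightarrow> real"

definition indices :: "nat \<Rightarrow> nat \<Rightarrow> index set" where
  "indices d N = {1..d} \<rightarrow>\<^sub>E {1..N}"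

definition tensors :: "nat \<Rightarrow> nat \<Rightarrow> tensor set" where
  "tensors d N = {T. \<forall>\<omega>. \<omega> \<notin> indices d N \<longrightarrow> T \<omega> = 0}"

definition tensor_inf_norm :: "nat \<Rightarrow> nat \<Rightarrow> tensor \<Rightarrow> real" where
  "tensor_inf_norm d N T = Max ((\<lambda>\<omega>. \<bar>T \<omega>\<bar>) ` indices d N)"

definition weighted_norm :: "nat \<Rightarrow> nat \<Rightarrow> index pmf \<Rightarrow> tensor \<Rightarrow> real" where
  "weighted_norm d N \<pi> T = sqrt (\<Sum>\<omega>\<in>indices d N. pmf \<pi> \<omega> * (T \<omega>)\<^sup>2)"

definition vector_outer :: "nat \<Rightarrow> nat \<Rightarrow> (nat \<Rightarrow> nat \<Rightarrow> real) \<Rightarrow> tensor" where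
  "vector_outer d N u = (\<lambda>\<omega>. if \<omega> \<in> indices d N then \<Prod>j=1..d. u j (\<omega> j) else 0)"

definition rank_one_tensors :: "nat \<Rightarrow> nat \<Rightarrow> tensor set" where
  "rank_one_tensors d N = {T. T \<noteq> 0 \<and> (\<exists>u. T = vector_outer d N u)}"

definition cp_rank :: "nat \<Rightarrow> nat \<Rightarrow> tensor \<Rightarrow> nat" where
  "cp_rank d N T =
     (LEAST r. \<exists>S. (\<forall>i\<in>{1..r}. S i \<in> rank_one_tensors d N) \<and> T = (\<Sum>i=1..r. S i))"

section \<open>The max-qnorm and the M-norm\<close>

text \<open>An \<open>N \<times> k\<close> matrix is a function \<open>A\<close> of which only the values \<open>A i l\<close> with
  \<open>i \<in> {1..N}\<close> and \<open>l \<in> {1..k}\<close> are used.\<close>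

definition row_norm :: "nat \<Rightarrow> nat \<Rightarrow> (nat \<Rightarrow> nat \<Rightarrow> real) \<Rightarrow> real" where
  "row_norm N k A = Max ((\<lambda>i. L2_set (A i) {1..k}) ` {1..N})"

definition matrix_outer ::
    "nat \<Rightarrow> nat \<Rightarrow> nat \<Rightarrow> (nat \<Rightarrow> nat \<Rightarrow> nat \<Rightarrow> real) \<Rightarrow> tensor" where
  "matrix_outer d N k U =
     (\<lambda>\<omega>. if \<omega> \<in> indices d N then \<Sum>l=1..k. \<Prod>j=1..d. U j (\<omega> j) l else 0)"

text \<open>The number of columns \<open>k\<close> is unbounded, so the minimum over all factorizations is taken as
  an infimum; the two agree whenever the minimum is attained.\<close>

definition max_qnorm :: "nat \<Rightarrow> nat \<Rightarrow> tensor \<Rightarrow> real" where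
  "max_qnorm d N T = Inf {\<Prod>j=1..d. row_norm N k (U j) | k U. T = matrix_outer d N k U}"

definition sign_tensors :: "nat \<Rightarrow> nat \<Rightarrow> tensor set" where
  "sign_tensors d N = {T \<in> rank_one_tensors d N. \<forall>\<omega>\<in>indices d N. T \<omega> \<in> {-1, 1}}"

definition M_norm :: "nat \<Rightarrow> nat \<Rightarrow> tensor \<Rightarrow> real" where
  "M_norm d N T = Inf {t. t > 0 \<and> T \<in> (*\<^sub>R) t ` (convex hull sign_tensors d N)}"

definition K_max :: "nat \<Rightarrow> nat \<Rightarrow> real \<Rightarrow> real \<Rightarrow> tensor set" where
  "K_max d N \<alpha> R = {T \<in> tensors d N. tensor_inf_norm d N T \<le> \<alpha> \<and> max_qnorm d N T \<le> R}"

definition K_M :: "nat \<Rightarrow> nat \<Rightarrow> real \<Rightarrow> real \<Rightarrow> tensor set" where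
  "K_M d N \<alpha> R = {T \<in> tensors d N. tensor_inf_norm d N T \<le> \<alpha> \<and> M_norm d N T \<le> R}"

text \<open>Order \<open>1\<close> has to be excluded: the infimum defining the max-qnorm is then \<open>0\<close> for every
  tensor (spread each entry over many columns), so no constants could satisfy the inequality.\<close>

definition grothendieck_constants :: "real \<Rightarrow> real \<Rightarrow> bool" where
  "grothendieck_constants c1 c2 \<longleftrightarrow>
     (\<forall>d\<ge>2. \<forall>N\<ge>1. \<forall>T\<in>tensors d N. M_norm d N T \<le> c1 * c2 ^ d * max_qnorm d N T)"

section \<open>The link function\<close>

definition L_const :: "(real \<Rightarrow> real) \<Rightarrow> real \<Rightarrow> real" where
  "L_const f \<alpha> = (SUP x\<in>{-\<alpha>..\<alpha>}. \<bar>deriv f x\<bar> / (f x * (1 - f x)))"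

definition \<beta>_const :: "(real \<Rightarrow> real) \<Rightarrow> real \<Rightarrow> real" where
  "\<beta>_const f \<alpha> = (SUP x\<in>{-\<alpha>..\<alpha>}. f x * (1 - f x) / (deriv f x)\<^sup>2)"

definition U_const :: "(real \<Rightarrow> real) \<Rightarrow> real \<Rightarrow> real" where
  "U_const f \<alpha> = (SUP x\<in>{-\<alpha>..\<alpha>}. ln (1 / (f x * (1 - f x))))"

text \<open>No denominator vanishes: at a point of \<open>[-\<alpha>, \<alpha>]\<close> with \<open>f x = 1\<close> the function \<open>f\<close> would
  have a maximum, hence derivative \<open>0\<close>.\<close>

definition admissible_link :: "(real \<Rightarrow> real) \<Rightarrow> real \<Rightarrow> bool" where
  "admissible_link f \<alpha> \<longleftrightarrow>
     range f \<subseteq> {0..1} \<and> (mono f \<or> antimono f) \<and> (\<forall>x. f differentiable (at x)) \<and>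
     (\<forall>x\<in>{-\<alpha>..\<alpha>}. f x \<noteq> 0 \<and> deriv f x \<noteq> 0) \<and>
     bdd_above ((\<lambda>x. \<bar>deriv f x\<bar> / (f x * (1 - f x))) ` {-\<alpha>..\<alpha>}) \<and>
     bdd_above ((\<lambda>x. f x * (1 - f x) / (deriv f x)\<^sup>2) ` {-\<alpha>..\<alpha>}) \<and>
     bdd_above ((\<lambda>x. ln (1 / (f x * (1 - f x)))) ` {-\<alpha>..\<alpha>})"

section \<open>Observations and likelihood\<close>

definition bit_pmf :: "real \<Rightarrow> int pmf" where
  "bit_pmf p = map_pmf (\<lambda>b. if b then 1 else -1) (bernoulli_pmf p)"

text \<open>Joint law of the sampled indices \<open>\<omega> 1, \<dots>, \<omega> m\<close> and of the bits \<open>Y 1, \<dots>, Y m\<close>, which are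
  independent given the indices. The values outside \<open>{1..m}\<close> are dummies.\<close>

definition observations ::
    "nat \<Rightarrow> index pmf \<Rightarrow> (real \<Rightarrow> real) \<Rightarrow> tensor \<Rightarrow> ((nat \<Rightarrow> index) \<times> (nat \<Rightarrow> int)) pmf" where
  "observations m \<pi> f T =
     bind_pmf (Pi_pmf {1..m} undefined (\<lambda>_. \<pi>)) (\<lambda>\<omega>.
       map_pmf (Pair \<omega>) (Pi_pmf {1..m} 0 (\<lambda>i. bit_pmf (f (T (\<omega> i))))))"

definition neg_log_likelihood ::
    "nat \<Rightarrow> (real \<Rightarrow> real) \<Rightarrow> (nat \<Rightarrow> index) \<Rightarrow> (nat \<Rightarrow> int) \<Rightarrow> tensor \<Rightarrow> real" where
  "neg_log_likelihood m f \<omega> Y X =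
     (\<Sum>i=1..m. of_bool (Y i = 1) * ln (1 / f (X (\<omega> i))) +
                of_bool (Y i = -1) * ln (1 / (1 - f (X (\<omega> i)))))"

end

theory Submission
  imports Defs "Jordan_Normal_Form.Determinant"
begin

text \<open>
  Both norm bounds come from one decomposition. Among the slices of a rank-\<open>r\<close> tensor along one
  mode one can choose at most \<open>r\<close> such that every slice is a combination of the chosen ones with
  coefficients in \<open>[-1, 1]\<close>: maximize the volume and apply Cramer's rule. Peeling off the modes in
  this way writes \<open>T\<close> as a sum of \<open>r ^ (d - 1)\<close> outer products whose entries are bounded by \<open>1\<close>,
  except for one factor that is bounded by \<open>\<alpha>\<close>; each such product lies in \<open>\<alpha> conv(T\<^sub>\<plusminus>)\<close>.

  For the statistical part, the excess loss of the minimizer is nonpositive, so its expectation, a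
  weighted sum of relative entropies, is at most the supremum over the constraint set of expected
  minus empirical excess loss. Bounded differences concentrate this supremum around its mean at
  scale \<open>U\<^sub>\<alpha>\<close>. Symmetrization and contraction at scale \<open>L\<^sub>\<alpha>\<close> reduce the mean to a Rademacher
  average, which is linear in the tensor and hence maximized over the M-ball at one of the at most
  \<open>2 ^ (d * N)\<close> sign tensors. Finally the relative entropy dominates the squared
  Hellinger distance, and thereby the squared distance of the entries divided by \<open>8 \<beta>\<^sub>\<alpha>\<close>. The bound
  for the max-qnorm follows because the max-qnorm ball lies in an M-ball, by Grothendieck's inequality.
\<close>

section \<open>Decomposition into bounded outer products\<close>

text \<open>Coordinates in a basis \<open>B\<close> turn tuples of \<open>dim X\<close> elements of
  \<open>X\<close> into square matrices; take a tuple \<open>k\<close> of maximal absolute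
  determinant. By Cramer's rule, replacing \<open>k j\<close> by \<open>x\<close> multiplies the
  determinant by the coefficient of \<open>x\<close> at \<open>k j\<close>, so maximality bounds
  that coefficient by 1.\<close>

lemma barycentric_spanner:
  fixes X :: "'a::real_vector set"
  assumes X: "finite X"
  shows "\<exists>k. (\<forall>j<dim X. k j \<in> X) \<and>
    (\<forall>x\<in>X. \<exists>c. (\<forall>j<dim X. \<bar>c j\<bar> \<le> (1::real)) \<and> x = (\<Sum>j<dim X. c j *\<^sub>R k j))"
proof -
  obtain B where B: "B \<subseteq> X" "independent B" "X \<subseteq> span B" "card B = dim X"
    using basis_exists by metis
  define n where "n = dim X"
  have finB: "finite B" using B X finite_subset by blast
  obtain e where e: "bij_betw e {..<n} B"
    using ex_bij_betw_nat_finite[OF finB] B(4) by (auto simp: n_def atLeast0LessThan)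
  define C where "C x i = representation B x (e i)" for x i
  define A where "A k = Matrix.mat n n (\<lambda>(i,j). C (k j) i)" for k :: "nat \<Rightarrow> 'a"
  define P where "P = ({..<n} \<rightarrow>\<^sub>E X)"
  have A_carrier: "A k \<in> carrier_mat n n" for k by (simp add: A_def)
  have expand: "x = (\<Sum>i<n. C x i *\<^sub>R e i)" if "x \<in> X" for x
  proof -
    have "x = (\<Sum>b\<in>B. representation B x b *\<^sub>R b)"
      using sum_representation_eq[OF B(2) _ finB order_refl] B(3) that by (simp add: subset_iff)
    also have "\<dots> = (\<Sum>i<n. C x i *\<^sub>R e i)"
      unfolding C_def by (rule sum.reindex_bij_betw[OF e, symmetric])
    finally show ?thesis .
  qed
  have "finite P" unfolding P_def using X by (intro finite_PiE) auto
  have e': "restrict e {..<n} \<in> P"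
    using e B(1) by (auto simp: P_def bij_betw_def)
  \<comment> \<open>The basis itself is one of the competing tuples and has determinant 1, so the
    maximum is nonzero and \<open>A k\<close> is invertible.\<close>
  have "A (restrict e {..<n}) = 1\<^sub>m n"
  proof (rule eq_matI)
    fix i j assume "i < dim_row (1\<^sub>m n)" "j < dim_col (1\<^sub>m n)"
    then have ij: "i < n" "j < n" by auto
    then have "e i = e j \<longleftrightarrow> i = j" using e by (auto simp: bij_betw_def inj_on_def)
    moreover have "e j \<in> B" using e ij by (auto simp: bij_betw_def)
    ultimately show "A (restrict e {..<n}) $$ (i, j) = 1\<^sub>m n $$ (i, j)"
      using ij B(2) by (simp add: A_def C_def representation_basis)
  qed (auto simp: A_def)
  then have det1: "\<bar>Determinant.det (A (restrict e {..<n}))\<bar> = 1" by simp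
  define D where "D k = \<bar>Determinant.det (A k)\<bar>" for k
  obtain k where k: "k \<in> P" and kmax: "\<And>k'. k' \<in> P \<Longrightarrow> D k' \<le> D k"
  proof -
    have "Max (D ` P) \<in> D ` P" using \<open>finite P\<close> e' by (intro Max_in) auto
    then obtain k where "k \<in> P" "Max (D ` P) = D k" by auto
    moreover then have "D k' \<le> D k" if "k' \<in> P" for k'
      using Max_ge[of "D ` P" "D k'"] \<open>finite P\<close> that by auto
    ultimately show ?thesis using that by blast
  qed
  have D1: "D k \<ge> 1" using kmax[OF e'] det1 by (simp add: D_def)
  then have "Determinant.det (A k) \<noteq> 0" by (auto simp: D_def)
  then have "A k \<in> Units (ring_mat TYPE(real) n ())"
    by (rule det_non_zero_imp_unit[OF A_carrier])
  then obtain A' where A': "A' \<in> carrier_mat n n" "A k * A' = 1\<^sub>m n"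
    by (auto simp: Units_def ring_mat_def)
  have kX: "k j \<in> X" if "j < n" for j using k that by (auto simp: P_def)
  have "\<exists>c. (\<forall>j<n. \<bar>c j\<bar> \<le> (1::real)) \<and> x = (\<Sum>j<n. c j *\<^sub>R k j)" if x: "x \<in> X" for x
  proof -
    define v where "v = Matrix.vec n (C x)"
    define c where "c = A' *\<^sub>v v"
    have v: "v \<in> carrier_vec n" by (simp add: v_def)
    have c: "c \<in> carrier_vec n" using A' v by (simp add: c_def)
    have Ac: "A k *\<^sub>v c = v"
      unfolding c_def using assoc_mult_mat_vec[OF A_carrier[of k] A'(1) v] A' v by simp
    have "\<bar>c $ j\<bar> \<le> 1" if j: "j < n" for j
    proof -
      have "Determinant.det (replace_col (A k) v j) = c $ j * Determinant.det (A k)"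
        using cramer_lemma_mat[OF A_carrier[of k] c j] Ac by simp
      moreover have "replace_col (A k) v j = A (k(j := x))"
        by (rule eq_matI) (auto simp: replace_col_def A_def v_def)
      ultimately have "D (k(j := x)) = \<bar>c $ j\<bar> * D k"
        by (simp add: D_def abs_mult)
      moreover have "k(j := x) \<in> P"
        using k x j by (auto simp: P_def PiE_iff extensional_def)
      ultimately have "\<bar>c $ j\<bar> * D k \<le> 1 * D k" using kmax by fastforce
      then show ?thesis using D1 by (simp add: mult_le_cancel_right)
    qed
    \<comment> \<open>The system solved by \<open>c\<close> equates the coordinates of
      \<open>x\<close> with those of the combination; expanding in the basis \<open>e\<close> and
      exchanging the sums returns to vectors.\<close>
    moreover have "x = (\<Sum>j<n. (c $ j) *\<^sub>R k j)"
    proof -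
      have Cx: "C x i = (\<Sum>j<n. C (k j) i * c $ j)" if "i < n" for i
      proof -
        have "C x i = (A k *\<^sub>v c) $ i" using that by (simp add: Ac v_def)
        also have "\<dots> = (\<Sum>j<n. C (k j) i * c $ j)"
          using that c by (simp add: A_def scalar_prod_def atLeast0LessThan)
        finally show ?thesis .
      qed
      have "x = (\<Sum>i<n. C x i *\<^sub>R e i)" by (rule expand[OF x])
      also have "\<dots> = (\<Sum>i<n. \<Sum>j<n. (C (k j) i * c $ j) *\<^sub>R e i)"
        by (intro sum.cong refl) (simp add: Cx scaleR_sum_left)
      also have "\<dots> = (\<Sum>j<n. \<Sum>i<n. (C (k j) i * c $ j) *\<^sub>R e i)" by (rule sum.swap)
      also have "\<dots> = (\<Sum>j<n. (c $ j) *\<^sub>R (\<Sum>i<n. C (k j) i *\<^sub>R e i))"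
        by (simp add: scaleR_sum_right mult.commute)
      also have "\<dots> = (\<Sum>j<n. (c $ j) *\<^sub>R k j)"
        by (intro sum.cong refl) (simp add: expand[OF kX, symmetric])
      finally show ?thesis .
    qed
    ultimately show ?thesis by (intro exI[of _ "\<lambda>j. c $ j"]) blast
  qed
  then show ?thesis using kX unfolding n_def by blast
qed

section \<open>Multi-indices, slices and outer products\<close>

lemma finite_indices [simp]: "finite (indices d N)"
  unfolding indices_def by (intro finite_PiE) auto

lemma indices_nonempty: "N \<ge> 1 \<Longrightarrow> indices d N \<noteq> {}"
  unfolding indices_def by (auto simp: PiE_eq_empty_iff)

lemma indices_range: "\<xi> \<in> indices d N \<Longrightarrow> j \<in> {1..d} \<Longrightarrow> \<xi> j \<in> {1..N}"
  unfolding indices_def by (rule PiE_mem)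

lemma indices_upd:
  assumes "\<xi> \<in> indices d N" "i \<in> {1..N}"
  shows "\<xi>(Suc d := i) \<in> indices (Suc d) N"
  using assms by (auto simp: indices_def PiE_iff extensional_def)

lemma indices_restrict:
  assumes "\<xi> \<in> indices (Suc d) N"
  shows "\<xi>(Suc d := undefined) \<in> indices d N"
  using assms by (auto simp: indices_def PiE_iff extensional_def)

lemma vector_outer_upd:
  assumes "\<xi> \<in> indices d N" "i \<in> {1..N}"
  shows "vector_outer (Suc d) N u (\<xi>(Suc d := i)) = u (Suc d) i * vector_outer d N u \<xi>"
proof -
  have "(\<Prod>j=1..d. u j ((\<xi>(Suc d := i)) j)) = (\<Prod>j=1..d. u j (\<xi> j))"
    by (intro prod.cong) auto
  then show ?thesis
    using assms indices_upd[OF assms] by (simp add: vector_outer_def mult.commute)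
qed

lemma scale_vector_outer:
  assumes "d \<ge> 1"
  shows "c *\<^sub>R vector_outer d N u = vector_outer d N (u(1 := \<lambda>i. c * u 1 i))"
proof
  fix \<xi>
  have "(\<Prod>j=1..d. (u(1 := \<lambda>i. c * u 1 i)) j (\<xi> j)) = c * (\<Prod>j=1..d. u j (\<xi> j))"
  proof -
    have "{1..d} = insert 1 {2..d}" using assms by auto
    moreover have "(\<Prod>j=2..d. (u(1 := \<lambda>i. c * u 1 i)) j (\<xi> j)) = (\<Prod>j=2..d. u j (\<xi> j))"
      by (intro prod.cong) auto
    ultimately show ?thesis by simp
  qed
  then show "(c *\<^sub>R vector_outer d N u) \<xi> = vector_outer d N (u(1 := \<lambda>i. c * u 1 i)) \<xi>"
    unfolding vector_outer_def scaleR_fun_def by simp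
qed

lemma sum_fun_apply: "(\<Sum>x\<in>A. g x) y = (\<Sum>x\<in>A. g x y)"
  for g :: "'a \<Rightarrow> 'b \<Rightarrow> real"
  by (induction A rule: infinite_finite_induct) auto

text \<open>Mode 1 is left over when the modes \<open>d, ..., 2\<close> are peeled off, so its
  factor keeps the size of the tensor entries, while the other factors hold spanner
  coefficients.\<close>

definition bounded_outers :: "nat \<Rightarrow> nat \<Rightarrow> real \<Rightarrow> tensor set" where
  "bounded_outers d N \<alpha> = {vector_outer d N u | u.
     \<forall>i\<in>{1..N}. \<bar>u 1 i\<bar> \<le> \<alpha> \<and> (\<forall>j\<in>{2..d}. \<bar>u j i\<bar> \<le> 1)}"

text \<open>Undoes slicing along the last mode. Indices are extensional functions, so resetting
  \<open>Suc d\<close> to \<open>undefined\<close> yields the index of order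
  \<open>d\<close>.\<close>

definition extend_mode :: "nat \<Rightarrow> nat \<Rightarrow> (nat \<Rightarrow> real) \<Rightarrow> tensor \<Rightarrow> tensor" where
  "extend_mode d N c w = (\<lambda>\<xi>. if \<xi> \<in> indices (Suc d) N
     then c (\<xi> (Suc d)) * w (\<xi>(Suc d := undefined)) else 0)"

lemma extend_mode_bounded:
  assumes "d \<ge> 1" "w \<in> bounded_outers d N \<alpha>" "\<And>i. i \<in> {1..N} \<Longrightarrow> \<bar>c i\<bar> \<le> 1"
  shows "extend_mode d N c w \<in> bounded_outers (Suc d) N \<alpha>"
proof -
  obtain u where w: "w = vector_outer d N u"
    and u: "\<forall>i\<in>{1..N}. \<bar>u 1 i\<bar> \<le> \<alpha> \<and> (\<forall>j\<in>{2..d}. \<bar>u j i\<bar> \<le> 1)"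
    using assms(2) by (auto simp: bounded_outers_def)
  have "extend_mode d N c w = vector_outer (Suc d) N (u(Suc d := c))"
  proof
    fix \<xi> show "extend_mode d N c w \<xi> = vector_outer (Suc d) N (u(Suc d := c)) \<xi>"
    proof (cases "\<xi> \<in> indices (Suc d) N")
      case True
      have "(\<Prod>j=1..d. u j ((\<xi>(Suc d := undefined)) j)) = (\<Prod>j=1..d. (u(Suc d := c)) j (\<xi> j))"
        by (intro prod.cong) auto
      then show ?thesis using True indices_restrict[OF True]
        by (simp add: extend_mode_def w vector_outer_def mult.commute)
    qed (simp add: extend_mode_def vector_outer_def)
  qed
  moreover have "\<forall>i\<in>{1..N}. \<bar>(u(Suc d := c)) 1 i\<bar> \<le> \<alpha> \<and> (\<forall>j\<in>{2..Suc d}. \<bar>(u(Suc d := c)) j i\<bar> \<le> 1)"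
    using u assms(1,3) by auto
  ultimately show ?thesis unfolding bounded_outers_def by blast
qed

lemma extend_mode_sum_list:
  "extend_mode d N c (sum_list ws) = sum_list (map (extend_mode d N c) ws)"
proof -
  have "extend_mode d N c 0 = 0" and "extend_mode d N c (v + w) = extend_mode d N c v + extend_mode d N c w"
    for v w by (auto simp: extend_mode_def fun_eq_iff algebra_simps)
  then show ?thesis by (induction ws) auto
qed

lemma sum_list_concat_map_upt:
  "sum_list (concat (map f [0..<n])) = (\<Sum>j<n. sum_list (f j))"
  for f :: "nat \<Rightarrow> 'a::comm_monoid_add list"
  by (induction n) (auto simp: add.commute)

lemma length_concat_map_upt:
  "(\<And>j. j < n \<Longrightarrow> length (f j) \<le> k) \<Longrightarrow> length (concat (map f [0..<n])) \<le> n * k"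
proof (induction n)
  case (Suc n)
  then have "length (concat (map f [0..<n])) \<le> n * k" "length (f n) \<le> k" by auto
  then show ?case by simp
qed auto

text \<open>Induction on the order. The slices along the last mode lie in the span of
  \<open>r\<close> outer products, so a barycentric spanner of them has at most \<open>r\<close>
  elements. These are slices of \<open>T\<close> themselves: they inherit the bound \<alpha> and are
  sums of \<open>r\<close> outer products, so the induction hypothesis applies to each, and the
  spanner coefficients form the last factor.\<close>

lemma bounded_decomposition:
  assumes "d \<ge> 1" "T = (\<Sum>l<r. vector_outer d N (u l))"
    "\<And>\<xi>. \<xi> \<in> indices d N \<Longrightarrow> \<bar>T \<xi>\<bar> \<le> \<alpha>"
  shows "\<exists>ws. set ws \<subseteq> bounded_outers d N \<alpha> \<and> length ws \<le> r ^ (d - 1) \<and> T = sum_list ws"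
  using assms
proof (induction d arbitrary: T u rule: nat_induct_at_least)
  case base
  have eq: "\<xi> = (\<lambda>_. undefined)(1 := \<xi> 1)" if "\<xi> \<in> indices 1 N" for \<xi>
    using that by (auto simp: indices_def PiE_iff extensional_def fun_eq_iff)
  \<comment> \<open>\<open>(\<lambda>_. undefined)(1 := i)\<close> is the only extensional index of
    order 1 with value \<open>i\<close>; a tensor of order 1 is thus a single vector, in accordance
    with \<open>r ^ 0 = 1\<close>.\<close>
  let ?v = "\<lambda>j i. T ((\<lambda>_. undefined)(1 := i))"
  have "T = vector_outer 1 N ?v"
  proof
    fix \<xi>
    show "T \<xi> = vector_outer 1 N ?v \<xi>"
    proof (cases "\<xi> \<in> indices 1 N")
      case True
      then show ?thesis using eq[OF True] by (simp add: vector_outer_def)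
    next
      case False
      then show ?thesis by (simp add: base sum_fun_apply vector_outer_def)
    qed
  qed
  moreover have "\<bar>?v 1 i\<bar> \<le> \<alpha>" if "i \<in> {1..N}" for i
    by (rule base) (use that in \<open>auto simp: indices_def PiE_iff extensional_def\<close>)
  ultimately have "T \<in> bounded_outers 1 N \<alpha>"
    unfolding bounded_outers_def by fastforce
  then show ?case by (intro exI[of _ "[T]"]) auto
next
  case (Suc d)
  define slice where "slice i = (\<lambda>\<xi>. if \<xi> \<in> indices d N then T (\<xi>(Suc d := i)) else 0)" for i
  have slice: "slice i = (\<Sum>l<r. u l (Suc d) i *\<^sub>R vector_outer d N (u l))" if "i \<in> {1..N}" for i
  proof
    fix \<xi>
    show "slice i \<xi> = (\<Sum>l<r. u l (Suc d) i *\<^sub>R vector_outer d N (u l)) \<xi>"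
    proof (cases "\<xi> \<in> indices d N")
      case True
      then show ?thesis
        by (simp add: slice_def Suc.prems(1) sum_fun_apply vector_outer_upd[OF True that] scaleR_fun_def)
    next
      case False
      then show ?thesis by (simp add: slice_def sum_fun_apply scaleR_fun_def vector_outer_def)
    qed
  qed
  let ?S = "(\<lambda>l. vector_outer d N (u l)) ` {..<r}"
  define X where "X = slice ` {1..N}"
  define n where "n = dim X"
  have "X \<subseteq> span ?S"
    unfolding X_def using slice by (auto intro!: span_sum span_scale intro: span_base)
  then have "n \<le> card ?S" unfolding n_def by (intro dim_le_card) auto
  also have "\<dots> \<le> r" using card_image_le[of "{..<r}"] by simp
  finally have n: "n \<le> r" .
  obtain k where k: "\<And>j. j < n \<Longrightarrow> k j \<in> X"
    and sp: "\<And>x. x \<in> X \<Longrightarrow> \<exists>c. (\<forall>j<n. \<bar>c j\<bar> \<le> (1::real)) \<and> x = (\<Sum>j<n. c j *\<^sub>R k j)"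
    using barycentric_spanner[of X] by (auto simp: n_def X_def)
  have "\<forall>i\<in>{1..N}. \<exists>c. (\<forall>j<n. \<bar>c j\<bar> \<le> (1::real)) \<and> slice i = (\<Sum>j<n. c j *\<^sub>R k j)"
    using sp by (auto simp: X_def)
  then obtain c where c: "\<And>i j. i \<in> {1..N} \<Longrightarrow> j < n \<Longrightarrow> \<bar>c i j\<bar> \<le> (1::real)"
    and slice_c: "\<And>i. i \<in> {1..N} \<Longrightarrow> slice i = (\<Sum>j<n. c i j *\<^sub>R k j)"
    by metis
  have "\<exists>ws. set ws \<subseteq> bounded_outers d N \<alpha> \<and> length ws \<le> r ^ (d - 1) \<and> k j = sum_list ws"
    if j: "j < n" for j
  proof -
    obtain i where i: "i \<in> {1..N}" "k j = slice i" using k[OF j] by (auto simp: X_def)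
    show ?thesis
    proof (rule Suc.IH)
      \<comment> \<open>The last-mode entries are constant on a slice and are absorbed into the
        first factors.\<close>
      show "k j = (\<Sum>l<r. vector_outer d N ((u l)(1 := \<lambda>i'. u l (Suc d) i * u l 1 i')))"
        using i slice scale_vector_outer[OF Suc.hyps] by simp
      show "\<bar>k j \<xi>\<bar> \<le> \<alpha>" if "\<xi> \<in> indices d N" for \<xi>
      proof -
        have "k j \<xi> = T (\<xi>(Suc d := i))" using that by (simp only: i(2) slice_def if_True)
        then show ?thesis using Suc.prems(2)[OF indices_upd[OF that i(1)]] by metis
      qed
    qed
  qed
  then obtain ws where ws: "\<And>j. j < n \<Longrightarrow> set (ws j) \<subseteq> bounded_outers d N \<alpha>"
    "\<And>j. j < n \<Longrightarrow> length (ws j) \<le> r ^ (d - 1)" "\<And>j. j < n \<Longrightarrow> k j = sum_list (ws j)"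
    by metis
  \<comment> \<open>Each term of the \<open>j\<close>-th chosen slice is extended by the vector of
    all coefficients at \<open>k j\<close>; at most \<open>r\<close> lists of length at most
    \<open>r ^ (d - 1)\<close> are joined.\<close>
  let ?ws = "concat (map (\<lambda>j. map (extend_mode d N (\<lambda>i. c i j)) (ws j)) [0..<n])"
  have "set ?ws \<subseteq> bounded_outers (Suc d) N \<alpha>"
  proof
    fix w assume "w \<in> set ?ws"
    then obtain j v where j: "j < n" and v: "v \<in> set (ws j)" and w: "w = extend_mode d N (\<lambda>i. c i j) v"
      by auto
    show "w \<in> bounded_outers (Suc d) N \<alpha>"
      unfolding w by (rule extend_mode_bounded[OF Suc.hyps subsetD[OF ws(1)[OF j] v] c[OF _ j]])
  qed
  moreover have "length ?ws \<le> r ^ (Suc d - 1)"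
  proof -
    have "length ?ws \<le> n * r ^ (d - 1)" by (rule length_concat_map_upt) (use ws in auto)
    also have "\<dots> \<le> r * r ^ (d - 1)" using n by simp
    also have "\<dots> = r ^ (Suc d - 1)" using Suc.hyps by (simp flip: power_Suc)
    finally show ?thesis .
  qed
  moreover have "T = sum_list ?ws"
  proof
    fix \<xi>
    have "sum_list ?ws \<xi> = (\<Sum>j<n. extend_mode d N (\<lambda>i. c i j) (k j) \<xi>)"
      by (simp add: sum_list_concat_map_upt extend_mode_sum_list[symmetric] sum_fun_apply ws(3))
    also have "\<dots> = T \<xi>"
    proof (cases "\<xi> \<in> indices (Suc d) N")
      case True
      have i: "\<xi> (Suc d) \<in> {1..N}" using indices_range[OF True] by simp
      have "T \<xi> = slice (\<xi> (Suc d)) (\<xi>(Suc d := undefined))"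
        using indices_restrict[OF True] by (simp add: slice_def)
      then show ?thesis using True slice_c[OF i]
        by (simp add: extend_mode_def sum_fun_apply scaleR_fun_def)
    next
      case False
      then show ?thesis
        by (simp add: extend_mode_def Suc.prems(1) sum_fun_apply vector_outer_def)
    qed
    finally show "T \<xi> = sum_list ?ws \<xi>" by simp
  qed
  ultimately show ?case by blast
qed

section \<open>Attaining the CP rank\<close>

text \<open>Ensures that the \<open>LEAST\<close> in \<open>cp_rank\<close> is attained: one scaled
  outer product of unit vectors per entry. Zero entries are left out because a rank-one tensor has
  to be nonzero.\<close>

lemma sum_of_basis_outers:
  assumes "d \<ge> 1" "T \<in> tensors d N"
  shows "\<exists>(r::nat) S. (\<forall>i\<in>{1..r}. S i \<in> rank_one_tensors d N) \<and> T = (\<Sum>i=1..r. S i)"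
proof -
  define I where "I = {\<xi> \<in> indices d N. T \<xi> \<noteq> 0}"
  have "finite I" by (simp add: I_def)
  then obtain h where h: "bij_betw h {1..card I} I"
    using ex_bij_betw_nat_finite_1 by blast
  define E where "E \<tau> = T \<tau> *\<^sub>R vector_outer d N (\<lambda>j i. of_bool (i = \<tau> j))" for \<tau>
  have E_apply: "E \<tau> \<xi> = (if \<xi> = \<tau> then T \<tau> else 0)" if "\<tau> \<in> indices d N" for \<tau> \<xi>
  proof (cases "\<xi> \<in> indices d N")
    case True
    have "(\<Prod>j=1..d. of_bool (\<xi> j = \<tau> j)) = (of_bool (\<xi> = \<tau>) :: real)"
    proof (cases "\<xi> = \<tau>")
      case False
      then obtain j where "\<xi> j \<noteq> \<tau> j" by auto
      moreover then have "j \<in> {1..d}"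
        using True that unfolding indices_def by (metis PiE_arb)
      ultimately show ?thesis using False by (auto intro!: prod_zero)
    qed simp
    then show ?thesis using True by (simp add: E_def vector_outer_def scaleR_fun_def)
  next
    case False
    then show ?thesis using that by (auto simp: E_def vector_outer_def scaleR_fun_def)
  qed
  have "E \<tau> \<in> rank_one_tensors d N" if "\<tau> \<in> I" for \<tau>
  proof -
    have "E \<tau> \<tau> \<noteq> 0" using that by (simp add: I_def E_apply)
    then have "E \<tau> \<noteq> 0" by auto
    then show ?thesis unfolding rank_one_tensors_def E_def scale_vector_outer[OF assms(1)] by blast
  qed
  moreover have "T = (\<Sum>i=1..card I. E (h i))"
  proof -
    have "T = (\<Sum>\<tau>\<in>I. E \<tau>)"
    proof
      fix \<xi>
      have "(\<Sum>\<tau>\<in>I. E \<tau> \<xi>) = (\<Sum>\<tau>\<in>I. if \<xi> = \<tau> then T \<tau> else 0)"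
        by (intro sum.cong) (auto simp: I_def E_apply)
      also have "\<dots> = T \<xi>"
        using \<open>finite I\<close> assms(2) by (auto simp: I_def tensors_def sum.delta')
      finally show "T \<xi> = (\<Sum>\<tau>\<in>I. E \<tau>) \<xi>" by (simp add: sum_fun_apply)
    qed
    then show ?thesis using sum.reindex_bij_betw[OF h, of E] by simp
  qed
  moreover have "h i \<in> I" if "i \<in> {1..card I}" for i
    using bij_betwE[OF h] that by blast
  ultimately show ?thesis
    by (intro exI[of _ "card I"] exI[of _ "\<lambda>i. E (h i)"]) blast
qed

lemma cp_rank_decomposition:
  assumes "d \<ge> 1" "T \<in> tensors d N"
  shows "\<exists>u. T = (\<Sum>l<cp_rank d N T. vector_outer d N (u l))"
proof -
  obtain S where S: "\<forall>i\<in>{1..cp_rank d N T}. S i \<in> rank_one_tensors d N"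
    and T: "T = (\<Sum>i=1..cp_rank d N T. S i)"
    using LeastI_ex[OF sum_of_basis_outers[OF assms]] unfolding cp_rank_def by blast
  from S obtain u where "\<forall>i\<in>{1..cp_rank d N T}. S i = vector_outer d N (u i)"
    unfolding rank_one_tensors_def by (simp add: Bex_def) metis
  then have "(\<Sum>i=1..cp_rank d N T. S i) = (\<Sum>l<cp_rank d N T. vector_outer d N (u (Suc l)))"
    by (simp add: sum.atLeast1_atMost_eq)
  then show ?thesis using T by (intro exI[of _ "\<lambda>l. u (Suc l)"]) simp
qed

section \<open>The max-qnorm and the M-norm\<close>

lemma sign_product:
  fixes g :: "'a \<Rightarrow> real"
  assumes "\<And>j. j \<in> A \<Longrightarrow> g j \<in> {-1, 1}"
  shows "prod g A \<in> {-1, 1}"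
  using assms
proof (induction A rule: infinite_finite_induct)
  case (insert x F)
  then have "g x \<in> {-1, 1}" "prod g F \<in> {-1, 1}" by blast+
  then show ?case using insert.hyps by auto
qed auto

lemma sign_outer_in_sign_tensors:
  assumes "N \<ge> 1" "\<And>j i. j \<in> {1..d} \<Longrightarrow> i \<in> {1..N} \<Longrightarrow> u j i \<in> {-1, 1}"
  shows "vector_outer d N u \<in> sign_tensors d N"
proof -
  have sgn: "vector_outer d N u \<xi> \<in> {-1, 1}" if "\<xi> \<in> indices d N" for \<xi>
    using sign_product[of "{1..d}" "\<lambda>j. u j (\<xi> j)"] assms(2) indices_range[OF that] that
    by (simp add: vector_outer_def)
  obtain \<xi> where "\<xi> \<in> indices d N" using indices_nonempty[OF assms(1)] by blast
  then have "vector_outer d N u \<noteq> 0" using sgn by force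
  then show ?thesis using sgn by (auto simp: sign_tensors_def rank_one_tensors_def)
qed

text \<open>An outer product is affine in each single factor entry. For an entry in [-1, 1] the two
  weights are nonnegative with sum 1, which makes this a convex combination.\<close>

lemma vector_outer_affine:
  assumes j: "j \<in> {1..d}"
  shows "vector_outer d N u = ((1 + u j i) / 2) *\<^sub>R vector_outer d N (u(j := (u j)(i := 1)))
    + ((1 - u j i) / 2) *\<^sub>R vector_outer d N (u(j := (u j)(i := -1)))"
proof
  fix \<xi>
  have split: "(\<Prod>l=1..d. (u(j := v)) l (\<xi> l)) = v (\<xi> j) * (\<Prod>l\<in>{1..d}-{j}. u l (\<xi> l))" for v
  proof -
    have "(\<Prod>l\<in>{1..d}-{j}. (u(j := v)) l (\<xi> l)) = (\<Prod>l\<in>{1..d}-{j}. u l (\<xi> l))"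
      by (intro prod.cong) auto
    then show ?thesis
      using prod.remove[of "{1..d}" j "\<lambda>l. (u(j := v)) l (\<xi> l)"] j by (simp del: fun_upd_apply) simp
  qed
  have "(\<Prod>l=1..d. u l (\<xi> l)) = u j (\<xi> j) * (\<Prod>l\<in>{1..d}-{j}. u l (\<xi> l))"
    using split[of "u j"] by simp
  then show "vector_outer d N u \<xi> = (((1 + u j i) / 2) *\<^sub>R vector_outer d N (u(j := (u j)(i := 1)))
    + ((1 - u j i) / 2) *\<^sub>R vector_outer d N (u(j := (u j)(i := -1)))) \<xi>"
    unfolding vector_outer_def scaleR_fun_def plus_fun_def split by (auto simp: field_simps)
qed

text \<open>Factor entries are rounded to 1 or -1 one at a time: induction on the set
  \<open>D\<close> of positions that need not hold signs, each step being the convex combination of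
  \<open>vector_outer_affine\<close>.\<close>

lemma vector_outer_in_hull:
  assumes "N \<ge> 1" "\<And>j i. j \<in> {1..d} \<Longrightarrow> i \<in> {1..N} \<Longrightarrow> \<bar>u j i\<bar> \<le> 1"
  shows "vector_outer d N u \<in> convex hull sign_tensors d N"
proof -
  have "vector_outer d N u \<in> convex hull sign_tensors d N"
    if "finite D" "D \<subseteq> {1..d} \<times> {1..N}"
      "\<And>j i. j \<in> {1..d} \<Longrightarrow> i \<in> {1..N} \<Longrightarrow> \<bar>u j i\<bar> \<le> 1"
      "\<And>j i. j \<in> {1..d} \<Longrightarrow> i \<in> {1..N} \<Longrightarrow> (j, i) \<notin> D \<Longrightarrow> u j i \<in> {-1, 1}" for D u
    using that
  proof (induction D arbitrary: u rule: finite_induct)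
    case empty
    then show ?case by (intro hull_inc sign_outer_in_sign_tensors assms(1)) auto
  next
    case (insert p D)
    obtain j i where p: "p = (j, i)" by force
    have ji: "j \<in> {1..d}" "i \<in> {1..N}" using insert.prems(1) p by auto
    have step: "vector_outer d N (u(j := (u j)(i := s))) \<in> convex hull sign_tensors d N"
      if "s \<in> {-1, 1}" for s
    proof (rule insert.IH)
      show "\<bar>(u(j := (u j)(i := s))) j' i'\<bar> \<le> 1" if "j' \<in> {1..d}" "i' \<in> {1..N}" for j' i'
        using insert.prems(2)[OF that] \<open>s \<in> {-1, 1}\<close> by auto
      show "(u(j := (u j)(i := s))) j' i' \<in> {-1, 1}"
        if "j' \<in> {1..d}" "i' \<in> {1..N}" "(j', i') \<notin> D" for j' i'
        using insert.prems(3)[OF that(1,2)] that(3) \<open>s \<in> {-1, 1}\<close> p by auto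
    qed (use insert.prems in auto)
    have "\<bar>u j i\<bar> \<le> 1" by (rule insert.prems(2)[OF ji])
    then have c: "0 \<le> (1 + u j i) / 2" "0 \<le> (1 - u j i) / 2" "(1 + u j i) / 2 + (1 - u j i) / 2 = 1"
      by (auto simp: field_simps)
    show ?case
      unfolding vector_outer_affine[OF ji(1), of N u i]
      by (rule convexD[OF convex_convex_hull _ _ c]) (use step in auto)
  qed
  from this[of "{1..d} \<times> {1..N}" u] show ?thesis using assms by auto
qed

lemma bounded_outer_in_hull:
  assumes "N \<ge> 1" "d \<ge> 1" "\<alpha> > 0" "w \<in> bounded_outers d N \<alpha>"
  shows "(1 / \<alpha>) *\<^sub>R w \<in> convex hull sign_tensors d N"
proof -
  obtain u where w: "w = vector_outer d N u"
    and u: "\<And>i. i \<in> {1..N} \<Longrightarrow> \<bar>u 1 i\<bar> \<le> \<alpha>"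
           "\<And>i j. i \<in> {1..N} \<Longrightarrow> j \<in> {2..d} \<Longrightarrow> \<bar>u j i\<bar> \<le> 1"
    using assms(4) by (auto simp: bounded_outers_def)
  show ?thesis
    unfolding w scale_vector_outer[OF assms(2)]
  proof (rule vector_outer_in_hull[OF assms(1)])
    fix j i assume "j \<in> {1..d}" "i \<in> {1..N}"
    then show "\<bar>(u(1 := \<lambda>i. 1 / \<alpha> * u 1 i)) j i\<bar> \<le> 1"
      using u(1)[of i] u(2)[of i j] \<open>\<alpha> > 0\<close> by (cases "j = 1") (auto simp: abs_mult)
  qed
qed

lemma scaleR_sum_list: "sum_list (map ((*\<^sub>R) c) ws) = c *\<^sub>R sum_list ws"
  for ws :: "'a::real_vector list"
  by (induction ws) (auto simp: scaleR_add_right)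

text \<open>Padding the list with zeros to length \<open>K\<close> gives a convex combination with
  equal weights \<open>1 / K\<close>.\<close>

lemma sum_list_in_hull:
  assumes "set ws \<subseteq> C" "convex C" "0 \<in> C" "length ws \<le> K" "K \<ge> 1"
  shows "(1 / real K) *\<^sub>R sum_list ws \<in> C"
proof -
  have "(\<Sum>i<K. (1 / real K) *\<^sub>R (if i < length ws then ws ! i else 0)) \<in> C"
    by (rule convex_sum) (use assms in \<open>auto simp: subset_iff\<close>)
  also have "(\<Sum>i<K. (1 / real K) *\<^sub>R (if i < length ws then ws ! i else 0)) =
      (1 / real K) *\<^sub>R (\<Sum>i<K. if i < length ws then ws ! i else 0)"
    by (rule scaleR_sum_right[symmetric])
  also have "(\<Sum>i<K. if i < length ws then ws ! i else 0) = (\<Sum>i<length ws. ws ! i)"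
    using assms(4) by (intro sum.mono_neutral_cong_right) auto
  also have "\<dots> = sum_list ws" by (simp add: sum_list_sum_nth atLeast0LessThan)
  finally show ?thesis .
qed

lemma bounded_outers_sum_in_hull:
  assumes "N \<ge> 1" "d \<ge> 1" "\<alpha> > 0" "set ws \<subseteq> bounded_outers d N \<alpha>" "length ws \<le> K" "K \<ge> 1"
  shows "sum_list ws \<in> (*\<^sub>R) (real K * \<alpha>) ` (convex hull sign_tensors d N)"
proof -
  let ?C = "convex hull sign_tensors d N"
  have zero: "0 \<in> ?C"
  proof -
    have "vector_outer d N (\<lambda>_ _. 0) \<in> ?C" by (rule vector_outer_in_hull[OF assms(1)]) auto
    moreover have "vector_outer d N (\<lambda>_ _. 0) = 0"
      using assms(2) by (auto simp: vector_outer_def fun_eq_iff)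
    ultimately show ?thesis by simp
  qed
  let ?f = "\<lambda>w. (1 / \<alpha>) *\<^sub>R w"
  have "(1 / real K) *\<^sub>R sum_list (map ?f ws) \<in> ?C"
    using assms bounded_outer_in_hull zero by (intro sum_list_in_hull) auto
  then have "(1 / real K) *\<^sub>R ?f (sum_list ws) \<in> ?C" by (simp only: scaleR_sum_list)
  moreover have "sum_list ws = (real K * \<alpha>) *\<^sub>R ((1 / real K) *\<^sub>R ?f (sum_list ws))"
    using assms(3,6) by simp
  ultimately show ?thesis by (rule rev_image_eqI[where f = "(*\<^sub>R) (real K * \<alpha>)"])
qed

section \<open>Upper bounds for the two norms\<close>

lemma M_norm_le:
  "t > 0 \<Longrightarrow> T \<in> (*\<^sub>R) t ` (convex hull sign_tensors d N) \<Longrightarrow> M_norm d N T \<le> t"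
  unfolding M_norm_def by (intro cInf_lower) (auto intro!: bdd_belowI[of _ 0])

lemma row_norm_nonneg: "N \<ge> 1 \<Longrightarrow> row_norm N k A \<ge> 0"
  unfolding row_norm_def by (subst Max_ge_iff) (auto intro!: bexI[of _ 1])

lemma row_norm_le:
  assumes "N \<ge> 1" "c \<ge> 0" "\<And>i l. i \<in> {1..N} \<Longrightarrow> l \<in> {1..k} \<Longrightarrow> \<bar>A i l\<bar> \<le> c"
  shows "row_norm N k A \<le> sqrt (real k) * c"
proof -
  have "L2_set (A i) {1..k} \<le> sqrt (real k) * c" if i: "i \<in> {1..N}" for i
  proof -
    have "(\<Sum>l=1..k. (A i l)\<^sup>2) \<le> (\<Sum>l=1..k. c\<^sup>2)"
      using assms(3)[OF i] by (intro sum_mono) (metis abs_ge_zero power_mono power2_abs)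
    then have "L2_set (A i) {1..k} \<le> sqrt (real k * c\<^sup>2)"
      unfolding L2_set_def by simp
    then show ?thesis using assms(2) by (simp add: real_sqrt_mult)
  qed
  then show ?thesis unfolding row_norm_def using assms(1) by (subst Max_le_iff) auto
qed

lemma max_qnorm_le:
  assumes "N \<ge> 1" "T = matrix_outer d N k U" "(\<Prod>j=1..d. row_norm N k (U j)) \<le> R"
  shows "max_qnorm d N T \<le> R"
  unfolding max_qnorm_def using assms
  by (intro cInf_lower2[OF _ assms(3)])
     (auto intro!: bdd_belowI[of _ 0] prod_nonneg row_norm_nonneg)

text \<open>The list entries become the columns of the factor matrices. A row of \<open>k\<close>
  entries bounded by 1 has norm at most \<open>sqrt k\<close>; only mode 1 carries the bound
  \<alpha>, so \<alpha> enters the product once.\<close>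

lemma max_qnorm_le_of_bounded_outers:
  assumes "N \<ge> 1" "d \<ge> 1" "\<alpha> > 0" "set ws \<subseteq> bounded_outers d N \<alpha>" "length ws \<le> K"
  shows "max_qnorm d N (sum_list ws) \<le> sqrt (real K ^ d) * \<alpha>"
proof -
  have "\<forall>l<length ws. \<exists>u. ws ! l = vector_outer d N u \<and>
      (\<forall>i\<in>{1..N}. \<bar>u 1 i\<bar> \<le> \<alpha> \<and> (\<forall>j\<in>{2..d}. \<bar>u j i\<bar> \<le> 1))"
    using assms(4) nth_mem unfolding bounded_outers_def by blast
  then obtain v where v: "\<And>l. l < length ws \<Longrightarrow> ws ! l = vector_outer d N (v l)"
    "\<And>l i. l < length ws \<Longrightarrow> i \<in> {1..N} \<Longrightarrow> \<bar>v l 1 i\<bar> \<le> \<alpha>"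
    "\<And>l i j. l < length ws \<Longrightarrow> i \<in> {1..N} \<Longrightarrow> j \<in> {2..d} \<Longrightarrow> \<bar>v l j i\<bar> \<le> 1"
    by metis
  define k where "k = length ws"
  \<comment> \<open>Columns are counted from 1, list positions from 0.\<close>
  define U where "U j i l = v (l - 1) j i" for j i l
  show ?thesis
  proof (rule max_qnorm_le[OF assms(1)])
    show "sum_list ws = matrix_outer d N k U"
    proof
      fix \<xi>
      have "sum_list ws \<xi> = (\<Sum>l<k. vector_outer d N (v l) \<xi>)"
        by (simp add: sum_list_sum_nth atLeast0LessThan sum_fun_apply v(1) k_def)
      also have "\<dots> = matrix_outer d N k U \<xi>"
        by (simp add: matrix_outer_def vector_outer_def U_def sum.atLeast1_atMost_eq)
      finally show "sum_list ws \<xi> = matrix_outer d N k U \<xi>" .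
    qed
    have "(\<Prod>j=1..d. row_norm N k (U j)) \<le> (\<Prod>j=1..d. sqrt (real k) * (if j = 1 then \<alpha> else 1))"
    proof (intro prod_mono conjI row_norm_nonneg assms(1) row_norm_le)
      fix j i l assume "j \<in> {1..d}" "i \<in> {1..N}" "l \<in> {1..k}"
      moreover then have "l - 1 < length ws" by (auto simp: k_def)
      ultimately show "\<bar>U j i l\<bar> \<le> (if j = 1 then \<alpha> else 1)"
        using v(2)[of "l - 1" i] v(3)[of "l - 1" i j] by (auto simp: U_def)
    qed (use assms(3) in auto)
    also have "\<dots> = sqrt (real k) ^ d * (\<Prod>j=1..d. if j = 1 then \<alpha> else 1)"
      by (simp add: prod.distrib)
    also have "(\<Prod>j=1..d. if j = 1 then \<alpha> else 1) = \<alpha>"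
      using assms(2) by (simp add: prod.delta)
    also have "sqrt (real k) ^ d * \<alpha> \<le> sqrt (real K) ^ d * \<alpha>"
      using assms(3,5) by (intro mult_right_mono power_mono) (auto simp: k_def)
    finally show "(\<Prod>j=1..d. row_norm N k (U j)) \<le> sqrt (real K ^ d) * \<alpha>"
      by (simp add: real_sqrt_power)
  qed
qed

lemma tensor_inf_norm_leD:
  assumes "tensor_inf_norm d N T \<le> \<alpha>" "\<xi> \<in> indices d N"
  shows "\<bar>T \<xi>\<bar> \<le> \<alpha>"
proof -
  have "\<bar>T \<xi>\<bar> \<le> tensor_inf_norm d N T"
    unfolding tensor_inf_norm_def by (rule Max_ge) (use assms in auto)
  then show ?thesis using assms by simp
qed

lemma tensor_abs_le:
  assumes "T \<in> tensors d N" "tensor_inf_norm d N T \<le> \<alpha>" "\<alpha> \<ge> 0"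
  shows "\<bar>T \<xi>\<bar> \<le> \<alpha>"
  using assms tensor_inf_norm_leD[OF assms(2)] by (cases "\<xi> \<in> indices d N") (auto simp: tensors_def)

section \<open>Sign tensors, norm bounds and the M-ball\<close>

text \<open>The factors of a sign tensor may be arbitrary reals, but each of its entries equals its
  own sign and \<open>sgn\<close> is multiplicative, so the factors can be replaced by signs. Then
  \<open>d * N\<close> signs determine the tensor.\<close>

lemma finite_card_sign_tensors:
  "finite (sign_tensors d N) \<and> card (sign_tensors d N) \<le> 2 ^ (d * N)"
proof -
  let ?P = "({1..d} \<times> {1..N}) \<rightarrow>\<^sub>E {-1, 1 :: real}"
  let ?g = "\<lambda>s. vector_outer d N (\<lambda>j i. s (j, i))"
  have fin: "finite ?P" by (intro finite_PiE) auto
  have sub: "sign_tensors d N \<subseteq> ?g ` ?P"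
  proof
    fix S assume S: "S \<in> sign_tensors d N"
    then obtain u where u: "S = vector_outer d N u"
      by (auto simp: sign_tensors_def rank_one_tensors_def)
    let ?s = "restrict (\<lambda>(j, i). if u j i < 0 then -1 else 1 :: real) ({1..d} \<times> {1..N})"
    have "S = ?g ?s"
    proof
      fix \<xi>
      show "S \<xi> = ?g ?s \<xi>"
      proof (cases "\<xi> \<in> indices d N")
        case True
        have S1: "(\<Prod>j=1..d. u j (\<xi> j)) \<in> {-1, 1}"
          using S True u by (auto simp: sign_tensors_def vector_outer_def)
        then have "(\<Prod>j=1..d. u j (\<xi> j)) \<noteq> 0"
          by (metis insertE singletonD zero_neq_neg_one zero_neq_one)
        then have nz: "u j (\<xi> j) \<noteq> 0" if "j \<in> {1..d}" for j
          using that by (auto simp: prod_zero_iff)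
        have "(\<Prod>j=1..d. u j (\<xi> j)) = sgn (\<Prod>j=1..d. u j (\<xi> j))" using S1 by auto
        also have "\<dots> = (\<Prod>j=1..d. sgn (u j (\<xi> j)))"
          by (induction d) (auto simp: sgn_mult)
        also have "\<dots> = (\<Prod>j=1..d. ?s (j, \<xi> j))"
        proof (rule prod.cong)
          fix j assume "j \<in> {1..d}"
          then show "sgn (u j (\<xi> j)) = ?s (j, \<xi> j)"
            using nz[of j] indices_range[OF True, of j] by (auto simp: sgn_if)
        qed simp
        finally show ?thesis using True by (simp add: u vector_outer_def)
      qed (simp add: u vector_outer_def)
    qed
    moreover have "?s \<in> ?P" by auto
    ultimately show "S \<in> ?g ` ?P" by blast
  qed
  have two: "card {-1, 1 :: real} = 2"
    by (subst card_2_iff) (intro exI[of _ "-1"] exI[of _ 1], auto)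
  have "card ?P = (\<Prod>p\<in>{1..d} \<times> {1..N}. card {-1, 1 :: real})" by (rule card_PiE) simp
  also have "\<dots> = 2 ^ (d * N)"
    unfolding two prod_constant card_cartesian_product card_atLeastAtMost diff_Suc_1 by (rule refl)
  finally have card_P: "card ?P = 2 ^ (d * N)" .
  have "card (sign_tensors d N) \<le> card ?P" by (rule surj_card_le[OF fin sub])
  then show ?thesis using finite_subset[OF sub finite_imageI[OF fin]] unfolding card_P by blast
qed

lemma sign_tensors_nonempty: "N \<ge> 1 \<Longrightarrow> sign_tensors d N \<noteq> {}"
  using sign_outer_in_sign_tensors[of N d "\<lambda>_ _. 1"] by auto

lemma uminus_sign_tensors:
  assumes "d \<ge> 1" "S \<in> sign_tensors d N"
  shows "- S \<in> sign_tensors d N"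
proof -
  obtain u where u: "S = vector_outer d N u"
    using assms by (auto simp: sign_tensors_def rank_one_tensors_def)
  have "- S = vector_outer d N (u(1 := \<lambda>i. (-1) * u 1 i))"
    unfolding u scale_vector_outer[OF assms(1), symmetric] by simp
  then have "\<exists>v. - S = vector_outer d N v" by blast
  moreover have "- S \<noteq> 0" "\<forall>\<xi>\<in>indices d N. (- S) \<xi> \<in> {-1, 1}"
    using assms(2) by (auto simp: sign_tensors_def rank_one_tensors_def)
  ultimately show ?thesis by (simp add: sign_tensors_def rank_one_tensors_def)
qed

lemma sign_tensors_abs_le: "S \<in> sign_tensors d N \<Longrightarrow> \<bar>S \<xi>\<bar> \<le> 1"
  by (cases "\<xi> \<in> indices d N")
     (auto simp: sign_tensors_def rank_one_tensors_def vector_outer_def)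

text \<open>The infimum defining \<open>M_norm\<close> is thereby taken over a nonempty set. The two
  summands 1 in the proof keep \<open>\<alpha>\<close> and the scaling factor positive, also for the
  zero tensor.\<close>

lemma tensor_in_scaled_hull:
  assumes "N \<ge> 1" "d \<ge> 1" "T \<in> tensors d N"
  shows "\<exists>t>0. T \<in> (*\<^sub>R) t ` (convex hull sign_tensors d N)"
proof -
  define \<alpha> where "\<alpha> = \<bar>tensor_inf_norm d N T\<bar> + 1"
  define r where "r = cp_rank d N T"
  obtain u where "T = (\<Sum>l<r. vector_outer d N (u l))"
    using cp_rank_decomposition[OF assms(2,3)] by (auto simp: r_def)
  moreover have "\<bar>T \<xi>\<bar> \<le> \<alpha>" if "\<xi> \<in> indices d N" for \<xi>
    by (rule tensor_inf_norm_leD[OF _ that]) (simp add: \<alpha>_def)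
  ultimately obtain ws where "set ws \<subseteq> bounded_outers d N \<alpha>" "length ws \<le> r ^ (d - 1)" "T = sum_list ws"
    using bounded_decomposition[OF assms(2)] by metis
  then have "T \<in> (*\<^sub>R) (real (r ^ (d - 1) + 1) * \<alpha>) ` (convex hull sign_tensors d N)"
    using bounded_outers_sum_in_hull[OF assms(1,2), of \<alpha> ws "r ^ (d - 1) + 1"] by (simp add: \<alpha>_def)
  moreover have "0 < real (r ^ (d - 1) + 1)" by (simp only: of_nat_0_less_iff)
  then have "0 < real (r ^ (d - 1) + 1) * \<alpha>" by (rule mult_pos_pos) (simp add: \<alpha>_def)
  ultimately show ?thesis by blast
qed

text \<open>Both bounds come from the decomposition into \<open>r ^ (d - 1)\<close> bounded outer
  products: as columns they cost \<open>sqrt (r ^ (d - 1))\<close> in each of the \<open>d\<close>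
  modes, in the hull they cost \<open>r ^ (d - 1)\<close> once.\<close>

lemma norm_bounds_of_rank:
  assumes "N \<ge> 1" "d \<ge> 1" "\<alpha> > 0" "T \<in> tensors d N" "cp_rank d N T = r" "r \<ge> 1"
    "tensor_inf_norm d N T \<le> \<alpha>"
  shows "max_qnorm d N T \<le> sqrt (real r ^ (d\<^sup>2 - d)) * \<alpha>"
    and "M_norm d N T \<le> (real r * sqrt (real r)) ^ (d - 1) * \<alpha>"
proof -
  from cp_rank_decomposition[OF assms(2,4)]
  obtain u where "T = (\<Sum>l<cp_rank d N T. vector_outer d N (u l))" ..
  note u = this[unfolded assms(5)]
  obtain ws where ws: "set ws \<subseteq> bounded_outers d N \<alpha>" "length ws \<le> r ^ (d - 1)"
    and T: "T = sum_list ws"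
    using bounded_decomposition[OF assms(2) u, of \<alpha>] tensor_inf_norm_leD[OF assms(7)] by blast
  have "(d - 1) * d = d\<^sup>2 - d" by (simp add: power2_eq_square algebra_simps)
  then have "real (r ^ (d - 1)) ^ d = real r ^ (d\<^sup>2 - d)"
    by (simp flip: power_mult)
  then show "max_qnorm d N T \<le> sqrt (real r ^ (d\<^sup>2 - d)) * \<alpha>"
    using max_qnorm_le_of_bounded_outers[OF assms(1-3) ws] by (simp add: T)
  have "M_norm d N T \<le> real (r ^ (d - 1)) * \<alpha>"
    unfolding T
  proof (rule M_norm_le)
    show "0 < real (r ^ (d - 1)) * \<alpha>" using assms(3,6) by (intro mult_pos_pos) auto
    show "sum_list ws \<in> (*\<^sub>R) (real (r ^ (d - 1)) * \<alpha>) ` (convex hull sign_tensors d N)"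
      by (rule bounded_outers_sum_in_hull[OF assms(1-3) ws one_le_power[OF assms(6)]])
  qed
  also have "\<dots> = real r ^ (d - 1) * 1 * \<alpha>" by simp
  \<comment> \<open>The bound reached so far is the stronger one; the additional factor
    \<open>sqrt r ^ (d - 1)\<close> is at least 1.\<close>
  also have "\<dots> \<le> (real r * sqrt (real r)) ^ (d - 1) * \<alpha>"
    unfolding power_mult_distrib using assms(3,6)
    by (intro mult_right_mono mult_left_mono one_le_power) auto
  finally show "M_norm d N T \<le> (real r * sqrt (real r)) ^ (d - 1) * \<alpha>" .
qed

lemma max_qnorm_nonneg:
  assumes "N \<ge> 1" "T = matrix_outer d N k U"
  shows "max_qnorm d N T \<ge> 0"
  unfolding max_qnorm_def
  by (rule cInf_greatest) (use assms in \<open>auto intro!: prod_nonneg row_norm_nonneg\<close>)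

text \<open>Grothendieck's inequality is tested on the all-ones tensor with \<open>N = 1\<close>,
  whose max-qnorm is at most 1 and whose M-norm is at least 1. The bound later allows terms to be
  enlarged by the factor \<open>c1 * c2 ^ d\<close>.\<close>

lemma grothendieck_constants_ge_1:
  assumes "grothendieck_constants c1 c2" "d \<ge> 2"
  shows "c1 * c2 ^ d \<ge> 1"
proof -
  define T where "T = vector_outer d 1 (\<lambda>_ _. 1)"
  have T: "T \<in> sign_tensors d 1" unfolding T_def by (rule sign_outer_in_sign_tensors) auto
  obtain \<xi> where \<xi>: "\<xi> \<in> indices d 1" using indices_nonempty[of 1 d] by auto
  have T\<xi>: "T \<xi> = 1" using \<xi> by (simp add: T_def vector_outer_def)
  have mo: "T = matrix_outer d 1 1 (\<lambda>_ _ _. 1)"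
    by (auto simp: T_def vector_outer_def matrix_outer_def)
  have q0: "max_qnorm d 1 T \<ge> 0" by (rule max_qnorm_nonneg[OF _ mo]) simp
  have "(\<Prod>j=1..d. row_norm 1 1 (\<lambda>_ _. 1)) \<le> (1::real)"
    by (intro prod_le_1 conjI row_norm_nonneg order_trans[OF row_norm_le[where c = 1]]) auto
  then have q1: "max_qnorm d 1 T \<le> 1" by (rule max_qnorm_le[OF order_refl mo])
  have "1 \<le> t" if t: "t > 0" "T \<in> (*\<^sub>R) t ` (convex hull sign_tensors d 1)" for t
  proof -
    obtain S where S: "S \<in> convex hull sign_tensors d 1" "T = t *\<^sub>R S" using t by auto
    \<comment> \<open>Evaluation at \<open>\<xi>\<close> is linear and at most 1 on the sign
      tensors, hence on their hull, so \<open>t * S \<xi> = 1\<close> forces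
      \<open>t \<ge> 1\<close>.\<close>
    have "convex hull sign_tensors d 1 \<subseteq> {S. S \<xi> \<le> 1}"
    proof (rule hull_minimal)
      show "sign_tensors d 1 \<subseteq> {S. S \<xi> \<le> 1}" using sign_tensors_abs_le[of _ d 1 \<xi>] by force
      show "convex {S :: tensor. S \<xi> \<le> 1}"
      proof (rule convexI)
        fix x y :: tensor and u v :: real
        assume *: "x \<in> {S. S \<xi> \<le> 1}" "y \<in> {S. S \<xi> \<le> 1}" "0 \<le> u" "0 \<le> v" "u + v = 1"
        then have "u * x \<xi> + v * y \<xi> \<le> u * 1 + v * 1" by (intro add_mono mult_left_mono) auto
        then show "u *\<^sub>R x + v *\<^sub>R y \<in> {S. S \<xi> \<le> 1}" using * by (simp add: scaleR_fun_def)
      qed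
    qed
    then have "S \<xi> \<le> 1" using S by auto
    then have "t * S \<xi> \<le> t * 1" using t by (intro mult_left_mono) auto
    then show ?thesis using S(2) T\<xi> by (simp add: scaleR_fun_def)
  qed
  moreover have "T \<in> (*\<^sub>R) 1 ` (convex hull sign_tensors d 1)"
    using hull_inc[OF T] by force
  ultimately have "1 \<le> M_norm d 1 T" unfolding M_norm_def
    by (intro cInf_greatest) (auto intro!: exI[of _ 1])
  also have "\<dots> \<le> c1 * c2 ^ d * max_qnorm d 1 T"
    using assms T\<xi> by (auto simp: grothendieck_constants_def T_def tensors_def vector_outer_def)
  finally have le: "1 \<le> c1 * c2 ^ d * max_qnorm d 1 T" .
  \<comment> \<open>The max-qnorm is nonnegative, so a negative constant would contradict
    \<open>le\<close>.\<close>
  then have "0 \<le> c1 * c2 ^ d" using q0 by (smt (verit) mult_nonpos_nonneg)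
  then have "c1 * c2 ^ d * max_qnorm d 1 T \<le> c1 * c2 ^ d * 1" using q1 by (intro mult_left_mono)
  then show ?thesis using le by simp
qed

text \<open>A bound for a linear functional on the sign tensors extends to their hull, and
  \<open>X\<close> lies in \<open>t\<close> times the hull for some \<open>t < R + e\<close>.
  Letting \<open>e\<close> tend to 0 avoids the question whether the infimum is attained.\<close>

lemma linear_bound_on_M_ball:
  fixes g :: "tensor \<Rightarrow> real"
  assumes "N \<ge> 1" "d \<ge> 1" "X \<in> tensors d N" "M_norm d N X \<le> R"
    and lin: "\<And>x y a b. g (a *\<^sub>R x + b *\<^sub>R y) = a * g x + b * g y"
    and B: "\<And>S. S \<in> sign_tensors d N \<Longrightarrow> g S \<le> B"
  shows "g X \<le> R * B"
proof -
  have gscale: "g (a *\<^sub>R x) = a * g x" for a x using lin[of a x 0 x] by simp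
  obtain S where S: "S \<in> sign_tensors d N" using sign_tensors_nonempty[OF assms(1)] by blast
  \<comment> \<open>With \<open>S\<close> also \<open>- S\<close> is a sign tensor, so
    \<open>B\<close> is nonnegative; this is what permits replacing \<open>t\<close> by
    \<open>R + e\<close> below.\<close>
  have "- g S \<le> B" using B[OF uminus_sign_tensors[OF assms(2) S]] gscale[of "-1" S] by simp
  then have B0: "B \<ge> 0" using B[OF S] by linarith
  have hull: "g Y \<le> B" if "Y \<in> convex hull sign_tensors d N" for Y
  proof -
    have "convex hull sign_tensors d N \<subseteq> {Y. g Y \<le> B}"
    proof (rule hull_minimal)
      show "convex {Y. g Y \<le> B}"
      proof (rule convexI)
        fix x y :: tensor and u v :: real
        assume *: "x \<in> {Y. g Y \<le> B}" "y \<in> {Y. g Y \<le> B}" "0 \<le> u" "0 \<le> v" "u + v = 1"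
        then have "u * g x + v * g y \<le> u * B + v * B" by (intro add_mono mult_left_mono) auto
        also have "\<dots> = B" using * by (simp flip: distrib_right)
        finally show "u *\<^sub>R x + v *\<^sub>R y \<in> {Y. g Y \<le> B}" using lin by simp
      qed
    qed (use B in auto)
    then show ?thesis using that by blast
  qed
  have "g X \<le> (R + e) * B" if "e > 0" for e
  proof -
    have "\<exists>t. t > 0 \<and> X \<in> (*\<^sub>R) t ` (convex hull sign_tensors d N) \<and> t < R + e"
      using cInf_lessD[of "{t. t > 0 \<and> X \<in> (*\<^sub>R) t ` (convex hull sign_tensors d N)}" "R + e"]
        tensor_in_scaled_hull[OF assms(1-3)] assms(4) that
      by (auto simp: M_norm_def)
    then obtain t Y where t: "t > 0" "X = t *\<^sub>R Y" "Y \<in> convex hull sign_tensors d N" "t < R + e"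
      by auto
    have "g X = t * g Y" using t gscale by simp
    also have "\<dots> \<le> t * B" using hull[OF t(3)] t by (intro mult_left_mono) auto
    also have "\<dots> \<le> (R + e) * B" using t B0 by (intro mult_right_mono) auto
    finally show ?thesis .
  qed
  then have "g X \<le> R * B + e" if "e > 0" for e
  proof (cases "B = 0")
    case True
    then show ?thesis using \<open>\<And>e. e > 0 \<Longrightarrow> g X \<le> (R + e) * B\<close>[of 1] that by simp
  next
    case False
    then show ?thesis
      using \<open>\<And>e. e > 0 \<Longrightarrow> g X \<le> (R + e) * B\<close>[of "e / B"] that B0 by (simp add: distrib_right)
  qed
  then show ?thesis by (rule field_le_epsilon)
qed

section \<open>Concentration and symmetrization\<close>

lemma expectation_mono_finite:
  fixes f g :: "'a \<Rightarrow> real"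
  assumes "finite (set_pmf p)" "\<And>x. x \<in> set_pmf p \<Longrightarrow> f x \<le> g x"
  shows "measure_pmf.expectation p f \<le> measure_pmf.expectation p g"
  using assms by (intro integral_mono_AE integrable_measure_pmf_finite) (auto simp: AE_measure_pmf_iff)

lemma expectation_bind_finite:
  fixes h :: "'b \<Rightarrow> real"
  assumes "finite (set_pmf p)" "\<And>x. x \<in> set_pmf p \<Longrightarrow> finite (set_pmf (q x))"
  shows "measure_pmf.expectation (bind_pmf p q) h =
    measure_pmf.expectation p (\<lambda>x. measure_pmf.expectation (q x) h)"
proof -
  have "measure_pmf.expectation (bind_pmf p q) h =
      (\<Sum>a\<in>set_pmf p. pmf p a *\<^sub>R measure_pmf.expectation (q a) h)"
    by (rule pmf_expectation_bind) (use assms in auto)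
  also have "\<dots> = measure_pmf.expectation p (\<lambda>x. measure_pmf.expectation (q x) h)"
    by (rule integral_measure_pmf[symmetric]) (use assms in auto)
  finally show ?thesis .
qed

lemma expectation_swap_finite:
  fixes h :: "'a \<Rightarrow> 'b \<Rightarrow> real"
  assumes p: "finite (set_pmf p)" and q: "finite (set_pmf q)"
  shows "measure_pmf.expectation p (\<lambda>x. measure_pmf.expectation q (\<lambda>y. h x y)) =
    measure_pmf.expectation q (\<lambda>y. measure_pmf.expectation p (\<lambda>x. h x y))"
proof -
  have "(\<Sum>x\<in>set_pmf p. pmf p x * (\<Sum>y\<in>set_pmf q. pmf q y * h x y)) =
      (\<Sum>y\<in>set_pmf q. pmf q y * (\<Sum>x\<in>set_pmf p. pmf p x * h x y))"
    by (subst (1 2) sum_distrib_left, subst sum.swap) (simp add: mult.left_commute)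
  then show ?thesis by (simp add: integral_measure_pmf[OF p] integral_measure_pmf[OF q])
qed

lemma finite_set_Pi_pmf:
  "finite A \<Longrightarrow> finite (set_pmf p) \<Longrightarrow> finite (set_pmf (Pi_pmf A dflt (\<lambda>_. p)))"
  by (simp add: set_Pi_pmf finite_PiE_dflt)

text \<open>Both orders of integration are needed: the new coordinate outermost for the
  bounded-difference induction, innermost for splitting off one sample in the
  symmetrization.\<close>

lemma expectation_Pi_pmf_insert:
  fixes F :: "('i \<Rightarrow> 'a) \<Rightarrow> real"
  assumes "finite A" "x \<notin> A" "finite (set_pmf p)"
  shows "measure_pmf.expectation (Pi_pmf (insert x A) dflt (\<lambda>_. p)) F =
      measure_pmf.expectation p (\<lambda>v. measure_pmf.expectation (Pi_pmf A dflt (\<lambda>_. p)) (\<lambda>z. F (z(x := v))))"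
    and "measure_pmf.expectation (Pi_pmf (insert x A) dflt (\<lambda>_. p)) F =
      measure_pmf.expectation (Pi_pmf A dflt (\<lambda>_. p)) (\<lambda>z. measure_pmf.expectation p (\<lambda>v. F (z(x := v))))"
proof -
  note fin = finite_set_Pi_pmf[OF assms(1,3), of dflt]
  show "measure_pmf.expectation (Pi_pmf (insert x A) dflt (\<lambda>_. p)) F =
      measure_pmf.expectation p (\<lambda>v. measure_pmf.expectation (Pi_pmf A dflt (\<lambda>_. p)) (\<lambda>z. F (z(x := v))))"
    unfolding Pi_pmf_insert'[OF assms(1,2)] using assms fin by (simp add: expectation_bind_finite)
  show "measure_pmf.expectation (Pi_pmf (insert x A) dflt (\<lambda>_. p)) F =
      measure_pmf.expectation (Pi_pmf A dflt (\<lambda>_. p)) (\<lambda>z. measure_pmf.expectation p (\<lambda>v. F (z(x := v))))"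
    unfolding Pi_pmf_insert'[OF assms(1,2)] bind_commute_pmf[of p]
    using assms fin by (simp add: expectation_bind_finite)
qed

lemma abs_expectation_le:
  fixes g :: "'a \<Rightarrow> real"
  assumes "finite (set_pmf p)" "\<And>x. x \<in> set_pmf p \<Longrightarrow> \<bar>g x\<bar> \<le> c"
  shows "\<bar>measure_pmf.expectation p g\<bar> \<le> c"
proof -
  have "measure_pmf.expectation p g \<le> measure_pmf.expectation p (\<lambda>_. c)"
    "measure_pmf.expectation p (\<lambda>_. - c) \<le> measure_pmf.expectation p g"
    by (intro expectation_mono_finite; use assms in \<open>force simp: abs_le_iff\<close>)+
  then show ?thesis by simp
qed

section \<open>Bounded differences\<close>

lemma mgf_bound:
  fixes g :: "'a \<Rightarrow> real"
  assumes "finite (set_pmf p)" "\<And>x. x \<in> set_pmf p \<Longrightarrow> \<bar>g x\<bar> \<le> c"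
    "measure_pmf.expectation p g = 0" "l > 0"
  shows "measure_pmf.expectation p (\<lambda>x. exp (l * g x)) \<le> exp (l\<^sup>2 * c\<^sup>2 / 2)"
proof -
  interpret interval_bounded_random_variable "measure_pmf p" g "-c" c
    using assms by unfold_locales (force simp: AE_measure_pmf_iff abs_le_iff)+
  have "ennreal (measure_pmf.expectation p (\<lambda>x. exp (l * g x))) = nn_integral p (\<lambda>x. exp (l * g x))"
    by (rule nn_integral_eq_integral[symmetric])
       (use assms in \<open>auto intro: integrable_measure_pmf_finite\<close>)
  also have "\<dots> \<le> ennreal (exp (l\<^sup>2 * (c - (-c))\<^sup>2 / 8))"
    by (rule Hoeffdings_lemma_nn_integral_0) (use assms in auto)
  finally have "measure_pmf.expectation p (\<lambda>x. exp (l * g x)) \<le> exp (l\<^sup>2 * (c - (-c))\<^sup>2 / 8)"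
    by simp
  also have "l\<^sup>2 * (c - (-c))\<^sup>2 / 8 = l\<^sup>2 * c\<^sup>2 / 2" by (simp add: power2_eq_square)
  finally show ?thesis .
qed

text \<open>Induction over the coordinates. With the new coordinate fixed to \<open>v\<close>, the
  induction hypothesis controls \<open>F\<close> around its conditional mean \<open>G v\<close>;
  averaging shows that \<open>G\<close> itself varies by at most \<open>c\<close>, so Hoeffding's
  lemma controls \<open>G\<close> around \<mu>. The two exponential factors multiply.\<close>

lemma bounded_differences_mgf:
  fixes F :: "('i \<Rightarrow> 'a) \<Rightarrow> real"
  assumes "finite A" "finite (set_pmf p)" "l > 0"
    "\<And>i z v w. i \<in> A \<Longrightarrow> \<bar>F (z(i := v)) - F (z(i := w))\<bar> \<le> c"
  shows "measure_pmf.expectation (Pi_pmf A dflt (\<lambda>_. p))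
      (\<lambda>z. exp (l * (F z - measure_pmf.expectation (Pi_pmf A dflt (\<lambda>_. p)) F)))
    \<le> exp (real (card A) * (l\<^sup>2 * c\<^sup>2 / 2))"
  using assms(1,4)
proof (induction A arbitrary: F rule: finite_induct)
  case (insert x A)
  let ?E = "measure_pmf.expectation (Pi_pmf A dflt (\<lambda>_. p))"
  define G where "G v = ?E (\<lambda>z. F (z(x := v)))" for v
  define \<mu> where "\<mu> = measure_pmf.expectation p G"
  have \<mu>: "measure_pmf.expectation (Pi_pmf (insert x A) dflt (\<lambda>_. p)) F = \<mu>"
    unfolding \<mu>_def G_def by (rule expectation_Pi_pmf_insert(1)) (use insert assms in auto)
  note fin = finite_set_Pi_pmf[OF insert.hyps(1) assms(2), of dflt]
  have int: "integrable (measure_pmf p) g" "integrable (measure_pmf (Pi_pmf A dflt (\<lambda>_. p))) g'"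
    for g :: "'a \<Rightarrow> real" and g' :: "('i \<Rightarrow> 'a) \<Rightarrow> real"
    using assms fin by (auto intro: integrable_measure_pmf_finite)
  have Gdiff: "\<bar>G v - G w\<bar> \<le> c" for v w
  proof -
    have "G v - G w = ?E (\<lambda>z. F (z(x := v)) - F (z(x := w)))"
      unfolding G_def by (simp add: Bochner_Integration.integral_diff int)
    then show ?thesis using abs_expectation_le[OF fin, of "\<lambda>z. F (z(x := v)) - F (z(x := w))" c] insert.prems by auto
  qed
  have G\<mu>: "\<bar>G v - \<mu>\<bar> \<le> c" for v
  proof -
    have "G v - \<mu> = measure_pmf.expectation p (\<lambda>w. G v - G w)"
      by (simp add: \<mu>_def Bochner_Integration.integral_diff int)
    then show ?thesis using abs_expectation_le[OF assms(2), of "\<lambda>w. G v - G w" c] Gdiff by simp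
  qed
  have IH: "?E (\<lambda>z. exp (l * (F (z(x := v)) - G v))) \<le> exp (real (card A) * (l\<^sup>2 * c\<^sup>2 / 2))" for v
    unfolding G_def
  proof (rule insert.IH)
    fix i z a b assume "i \<in> A"
    then have "i \<noteq> x" using insert.hyps by auto
    then have "(z(i := u))(x := v) = (z(x := v))(i := u)" for u by (rule fun_upd_twist)
    then show "\<bar>F ((z(i := a))(x := v)) - F ((z(i := b))(x := v))\<bar> \<le> c"
      using insert.prems[of i "z(x := v)" a b] \<open>i \<in> A\<close> by (simp only: insert_iff simp_thms)
  qed
  have "measure_pmf.expectation (Pi_pmf (insert x A) dflt (\<lambda>_. p)) (\<lambda>z. exp (l * (F z - \<mu>)))
      = measure_pmf.expectation p (\<lambda>v. ?E (\<lambda>z. exp (l * (F (z(x := v)) - \<mu>))))"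
    by (rule expectation_Pi_pmf_insert(1)) (use insert assms in auto)
  also have "\<dots> = measure_pmf.expectation p (\<lambda>v. exp (l * (G v - \<mu>)) * ?E (\<lambda>z. exp (l * (F (z(x := v)) - G v))))"
    by (subst Bochner_Integration.integral_mult_right_zero[symmetric])
       (simp add: exp_add[symmetric] algebra_simps)
  also have "\<dots> \<le> measure_pmf.expectation p (\<lambda>v. exp (l * (G v - \<mu>)) * exp (real (card A) * (l\<^sup>2 * c\<^sup>2 / 2)))"
    by (intro expectation_mono_finite assms mult_left_mono IH) auto
  also have "\<dots> = measure_pmf.expectation p (\<lambda>v. exp (l * (G v - \<mu>))) * exp (real (card A) * (l\<^sup>2 * c\<^sup>2 / 2))"
    by simp
  also have "\<dots> \<le> exp (l\<^sup>2 * c\<^sup>2 / 2) * exp (real (card A) * (l\<^sup>2 * c\<^sup>2 / 2))"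
  proof (intro mult_right_mono mgf_bound assms)
    show "measure_pmf.expectation p (\<lambda>v. G v - \<mu>) = 0"
      by (simp add: \<mu>_def Bochner_Integration.integral_diff int)
  qed (use G\<mu> in auto)
  also have "\<dots> = exp (real (card (insert x A)) * (l\<^sup>2 * c\<^sup>2 / 2))"
    using insert.hyps by (simp add: exp_add[symmetric] algebra_simps)
  finally show ?case unfolding \<mu> .
qed simp

lemma bounded_differences_tail:
  fixes F :: "('i \<Rightarrow> 'a) \<Rightarrow> real"
  assumes "finite A" "A \<noteq> {}" "finite (set_pmf p)" "c > 0" "0 < \<delta>" "\<delta> < 1"
    "\<And>i z v w. i \<in> A \<Longrightarrow> \<bar>F (z(i := v)) - F (z(i := w))\<bar> \<le> c"
  shows "measure_pmf.prob (Pi_pmf A dflt (\<lambda>_. p))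
      {z. F z \<le> measure_pmf.expectation (Pi_pmf A dflt (\<lambda>_. p)) F + c * sqrt (2 * real (card A) * ln (1 / \<delta>))}
    \<ge> 1 - \<delta>"
proof -
  let ?P = "Pi_pmf A dflt (\<lambda>_. p)"
  define \<mu> where "\<mu> = measure_pmf.expectation ?P F"
  define n where "n = real (card A)"
  define t where "t = c * sqrt (2 * n * ln (1 / \<delta>))"
  \<comment> \<open>This \<open>l\<close> minimizes the Chernoff exponent
    \<open>n * (l\<^sup>2 * c\<^sup>2 / 2) - l * t\<close>; the choice of \<open>t\<close> makes the
    minimum equal to \<open>- ln (1 / \<delta>)\<close>.\<close>
  define l where "l = t / (n * c\<^sup>2)"
  have n: "n > 0" using assms by (simp add: n_def card_gt_0_iff)
  have ln: "ln (1 / \<delta>) > 0" using assms by simp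
  have t: "t > 0" using n ln assms by (simp add: t_def)
  have l: "l > 0" using t n assms by (simp add: l_def)
  have fin: "finite (set_pmf ?P)" by (rule finite_set_Pi_pmf[OF assms(1,3)])
  have expo: "n * (l\<^sup>2 * c\<^sup>2 / 2) - l * t = - ln (1 / \<delta>)"
  proof -
    have "t\<^sup>2 = c\<^sup>2 * (2 * n * ln (1 / \<delta>))" using n ln by (simp add: t_def power_mult_distrib)
    moreover have "n * (l\<^sup>2 * c\<^sup>2 / 2) - l * t = - t\<^sup>2 / (2 * n * c\<^sup>2)"
      using n assms by (simp add: l_def field_simps power2_eq_square)
    ultimately show ?thesis using n assms by simp
  qed
  have "measure_pmf.prob ?P {z. \<not> F z \<le> \<mu> + t} = measure_pmf.expectation ?P (indicator {z. \<not> F z \<le> \<mu> + t})"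
    by simp
  also have "\<dots> \<le> measure_pmf.expectation ?P (\<lambda>z. exp (l * (F z - \<mu>)) * exp (- (l * t)))"
  proof (rule expectation_mono_finite[OF fin])
    fix z
    show "indicator {z. \<not> F z \<le> \<mu> + t} z \<le> exp (l * (F z - \<mu>)) * exp (- (l * t))"
    proof (cases "F z \<le> \<mu> + t")
      case False
      then have "0 \<le> l * (F z - \<mu> - t)" using l by simp
      then have "1 \<le> exp (l * (F z - \<mu> - t))" by simp
      also have "\<dots> = exp (l * (F z - \<mu>)) * exp (- (l * t))"
        by (simp add: exp_add[symmetric] algebra_simps)
      finally show ?thesis using False by simp
    qed simp
  qed
  also have "\<dots> = measure_pmf.expectation ?P (\<lambda>z. exp (l * (F z - \<mu>))) * exp (- (l * t))"
    by simp
  also have "\<dots> \<le> exp (n * (l\<^sup>2 * c\<^sup>2 / 2)) * exp (- (l * t))"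
    unfolding \<mu>_def n_def by (intro mult_right_mono bounded_differences_mgf assms l) auto
  also have "\<dots> = exp (n * (l\<^sup>2 * c\<^sup>2 / 2) - l * t)" by (simp add: exp_add[symmetric])
  also have "\<dots> = \<delta>" unfolding expo using assms by (simp add: ln_div)
  finally have "measure_pmf.prob ?P {z. \<not> F z \<le> \<mu> + t} \<le> \<delta>" .
  moreover have "measure_pmf.prob ?P {z. \<not> F z \<le> \<mu> + t} = 1 - measure_pmf.prob ?P {z. F z \<le> \<mu> + t}"
    using measure_pmf.prob_compl[of "{z. F z \<le> \<mu> + t}" ?P] by (simp add: Compl_eq_Diff_UNIV[symmetric] Collect_neg_eq)
  ultimately show ?thesis by (simp add: \<mu>_def t_def n_def)
qed

section \<open>Symmetrization with contraction\<close>

lemma cSUP_add_le: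
  fixes f g :: "'x \<Rightarrow> real"
  assumes "K \<noteq> {}" "\<And>X X'. X \<in> K \<Longrightarrow> X' \<in> K \<Longrightarrow> f X + g X' \<le> c"
  shows "(SUP X\<in>K. f X) + (SUP X\<in>K. g X) \<le> c"
proof -
  have "(SUP X\<in>K. f X) \<le> c - g X'" if "X' \<in> K" for X'
    using assms that by (intro cSUP_least) (auto simp: algebra_simps)
  then have "(SUP X\<in>K. g X) \<le> c - (SUP X\<in>K. f X)"
    using assms(1) by (intro cSUP_least) (auto simp: algebra_simps)
  then show ?thesis by simp
qed

lemma bdd_above_add_bounded:
  fixes a g :: "'x \<Rightarrow> real"
  assumes "bdd_above (a ` K)" "\<And>X. X \<in> K \<Longrightarrow> g X \<le> B"
  shows "bdd_above ((\<lambda>X. a X + g X) ` K)"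
proof -
  obtain M where "\<And>X. X \<in> K \<Longrightarrow> a X \<le> M" using assms(1) by (auto simp: bdd_above_def)
  then show ?thesis using assms(2) by (intro bdd_aboveI[of _ "M + B"]) (auto intro: add_mono)
qed

text \<open>Replacing the expectation of the loss by an independent copy \<open>z'\<close> and exchanging \<open>z\<close> with
  \<open>z'\<close>, two suprema occur together; for each pair of points of \<open>K\<close> their sum only involves
  differences of the loss at a single sample, to which the contraction hypothesis applies. The
  offset \<open>a\<close> lets the step be iterated over the samples.\<close>

lemma symmetrization_contraction_step:
  fixes l h :: "'z \<Rightarrow> 'x \<Rightarrow> real" and a :: "'x \<Rightarrow> real"
  assumes fin: "finite (set_pmf p)" and K: "K \<noteq> {}" and a: "bdd_above (a ` K)"
    and l: "\<And>z X. X \<in> K \<Longrightarrow> \<bar>l z X\<bar> \<le> B" and h: "\<And>z X. X \<in> K \<Longrightarrow> \<bar>h z X\<bar> \<le> B"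
    and lip: "\<And>z X X'. X \<in> K \<Longrightarrow> X' \<in> K \<Longrightarrow> \<bar>l z X - l z X'\<bar> \<le> \<bar>h z X - h z X'\<bar>"
  shows "measure_pmf.expectation p
      (\<lambda>z. SUP X\<in>K. a X + (measure_pmf.expectation p (\<lambda>z'. l z' X) - l z X))
    \<le> measure_pmf.expectation p
      (\<lambda>z. ((SUP X\<in>K. a X + 2 * h z X) + (SUP X\<in>K. a X - 2 * h z X)) / 2)"
proof -
  let ?E = "measure_pmf.expectation p"
  have int: "integrable (measure_pmf p) g" for g :: "'z \<Rightarrow> real"
    by (rule integrable_measure_pmf_finite[OF fin])
  define Q where "Q z z' = (SUP X\<in>K. a X + (l z' X - l z X))" for z z'
  define P1 where "P1 z = (SUP X\<in>K. a X + 2 * h z X)" for z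
  define P2 where "P2 z = (SUP X\<in>K. a X - 2 * h z X)" for z
  define P where "P z = P1 z + P2 z" for z
  have bddQ: "bdd_above ((\<lambda>X. a X + (l z' X - l z X)) ` K)" for z z'
  proof (rule bdd_above_add_bounded[OF a])
    fix X assume "X \<in> K"
    then show "l z' X - l z X \<le> 2 * B" using l[of X z] l[of X z'] by auto
  qed
  have bddh: "bdd_above ((\<lambda>X. a X + 2 * h z X) ` K)" "bdd_above ((\<lambda>X. a X - 2 * h z X) ` K)" for z
  proof -
    have "2 * h z X \<le> 2 * B" "- (2 * h z X) \<le> 2 * B" if "X \<in> K" for X using h[OF that, of z] by auto
    then show "bdd_above ((\<lambda>X. a X + 2 * h z X) ` K)" "bdd_above ((\<lambda>X. a X - 2 * h z X) ` K)"
      using bdd_above_add_bounded[OF a, of "\<lambda>X. 2 * h z X" "2 * B"]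
        bdd_above_add_bounded[OF a, of "\<lambda>X. - (2 * h z X)" "2 * B"]
      by auto
  qed
  \<comment> \<open>\<open>X\<close> and \<open>X'\<close> can be assigned to the two suprema either
    way; the better assignment produces the absolute value.\<close>
  have P_ge: "a X + a X' + 2 * \<bar>h z X - h z X'\<bar> \<le> P z" if X: "X \<in> K" "X' \<in> K" for X X' z
  proof -
    have "a Y + 2 * h z Y \<le> P1 z" "a Y - 2 * h z Y \<le> P2 z" if "Y \<in> K" for Y
      unfolding P1_def P2_def using cSUP_upper[OF that bddh(1)] cSUP_upper[OF that bddh(2)] by auto
    from this[OF X(1)] this[OF X(2)] show ?thesis unfolding P_def by (auto simp: abs_if)
  qed
  have pair: "Q z z' + Q z' z \<le> (P z + P z') / 2" for z z'
    unfolding Q_def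
  proof (rule cSUP_add_le[OF K])
    fix X X' assume X: "X \<in> K" "X' \<in> K"
    show "a X + (l z' X - l z X) + (a X' + (l z X' - l z' X')) \<le> (P z + P z') / 2"
    proof -
      have "l z' X - l z' X' \<le> \<bar>h z' X - h z' X'\<bar>" "l z X' - l z X \<le> \<bar>h z X - h z X'\<bar>"
        using lip[OF X, of z] lip[OF X, of z'] by (auto simp: abs_le_iff)
      then show ?thesis using P_ge[OF X, of z] P_ge[OF X, of z'] by argo
    qed
  qed
  have "?E (\<lambda>z. SUP X\<in>K. a X + (?E (\<lambda>z'. l z' X) - l z X)) \<le> ?E (\<lambda>z. ?E (\<lambda>z'. Q z z'))"
  proof (rule expectation_mono_finite[OF fin], rule cSUP_least[OF K])
    fix z X assume X: "X \<in> K"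
    have "a X + (?E (\<lambda>z'. l z' X) - l z X) = ?E (\<lambda>z'. a X + (l z' X - l z X))"
      by (simp add: int)
    also have "\<dots> \<le> ?E (\<lambda>z'. Q z z')"
      unfolding Q_def by (intro expectation_mono_finite fin cSUP_upper[OF X bddQ])
    finally show "a X + (?E (\<lambda>z'. l z' X) - l z X) \<le> ?E (\<lambda>z'. Q z z')" .
  qed
  \<comment> \<open>Exchanging the two independent copies leaves the double mean of \<open>Q\<close>
    unchanged, which brings in the pair bounded by \<open>pair\<close>.\<close>
  also have "\<dots> = (?E (\<lambda>z. ?E (\<lambda>z'. Q z z')) + ?E (\<lambda>z. ?E (\<lambda>z'. Q z' z))) / 2"
  proof -
    have "?E (\<lambda>z. ?E (\<lambda>z'. Q z z')) = ?E (\<lambda>z. ?E (\<lambda>z'. Q z' z))"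
      by (rule expectation_swap_finite[OF fin fin])
    then show ?thesis by simp
  qed
  also have "\<dots> = ?E (\<lambda>z. ?E (\<lambda>z'. Q z z' + Q z' z)) / 2" by (simp add: int)
  also have "\<dots> \<le> ?E (\<lambda>z. ?E (\<lambda>z'. (P z + P z') / 2)) / 2"
    by (intro divide_right_mono expectation_mono_finite fin pair) auto
  also have "\<dots> = ?E (\<lambda>z. P z / 2)" by (simp add: int)
  finally show ?thesis by (simp add: P_def P1_def P2_def)
qed

definition rademacher :: "bool \<Rightarrow> real" where
  "rademacher b = (if b then 1 else -1)"

text \<open>Attaches an independent fair sign to a sample, so that a single product law describes
  samples and signs together.\<close>

definition with_rademacher :: "'z pmf \<Rightarrow> ('z \<times> bool) pmf" where
  "with_rademacher p = bind_pmf p (\<lambda>z. map_pmf (Pair z) (bernoulli_pmf (1 / 2)))"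

lemma finite_set_with_rademacher: "finite (set_pmf p) \<Longrightarrow> finite (set_pmf (with_rademacher p))"
  by (simp add: with_rademacher_def)

lemma expectation_with_rademacher:
  fixes g :: "'z \<times> bool \<Rightarrow> real"
  assumes "finite (set_pmf p)"
  shows "measure_pmf.expectation (with_rademacher p) g =
    measure_pmf.expectation p (\<lambda>z. (g (z, True) + g (z, False)) / 2)"
  unfolding with_rademacher_def using assms
  by (subst expectation_bind_finite) (auto simp: add_divide_distrib)

lemma sum_insert_fun_upd:
  fixes g :: "'a \<Rightarrow> real"
  assumes "finite A" "x \<notin> A"
  shows "(\<Sum>i\<in>insert x A. g ((z(x := v)) i)) = g v + (\<Sum>i\<in>A. g (z i))"
proof -
  have "(\<Sum>i\<in>A. g ((z(x := v)) i)) = (\<Sum>i\<in>A. g (z i))"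
    using assms(2) by (intro sum.cong) auto
  then show ?thesis using assms by simp
qed

text \<open>Samples are converted one at a time. While the new sample is treated by the step lemma,
  the terms of the others belong to the offset; after the expectations are exchanged, its Rademacher
  term is part of the offset in the induction hypothesis.\<close>

lemma symmetrization_contraction:
  fixes l h :: "'z \<Rightarrow> 'x \<Rightarrow> real" and a :: "'x \<Rightarrow> real"
  assumes A: "finite A" and fin: "finite (set_pmf p)" and K: "K \<noteq> {}" and a: "bdd_above (a ` K)"
    and l: "\<And>z X. X \<in> K \<Longrightarrow> \<bar>l z X\<bar> \<le> B" and h: "\<And>z X. X \<in> K \<Longrightarrow> \<bar>h z X\<bar> \<le> B"
    and lip: "\<And>z X X'. X \<in> K \<Longrightarrow> X' \<in> K \<Longrightarrow> \<bar>l z X - l z X'\<bar> \<le> \<bar>h z X - h z X'\<bar>"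
  shows "measure_pmf.expectation (Pi_pmf A dflt (\<lambda>_. p))
      (\<lambda>z. SUP X\<in>K. a X + (\<Sum>i\<in>A. measure_pmf.expectation p (\<lambda>z'. l z' X) - l (z i) X))
    \<le> measure_pmf.expectation (Pi_pmf A dflt' (\<lambda>_. with_rademacher p))
      (\<lambda>y. SUP X\<in>K. a X + (\<Sum>i\<in>A. 2 * (rademacher (snd (y i)) * h (fst (y i)) X)))"
  using A a
proof (induction A arbitrary: a rule: finite_induct)
  case (insert x A)
  let ?E = "measure_pmf.expectation (Pi_pmf A dflt (\<lambda>_. p))"
  let ?E' = "measure_pmf.expectation (Pi_pmf A dflt' (\<lambda>_. with_rademacher p))"
  let ?\<Lambda> = "\<lambda>X. measure_pmf.expectation p (\<lambda>z'. l z' X)"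
  define S where "S z X = (\<Sum>i\<in>A. ?\<Lambda> X - l (z i) X)" for z X
  define S' where "S' y X = (\<Sum>i\<in>A. 2 * (rademacher (snd (y i)) * h (fst (y i)) X))" for y X
  note finA = finite_set_Pi_pmf[OF insert.hyps(1) fin, of dflt]
  note fin' = finite_set_with_rademacher[OF fin]
  have S_bdd: "S z X \<le> real (card A) * (2 * B)" if "X \<in> K" for z X
  proof -
    have "\<bar>?\<Lambda> X\<bar> \<le> B" using l that by (intro abs_expectation_le fin) auto
    then have "?\<Lambda> X - l (z i) X \<le> 2 * B" for i using l[OF that, of "z i"] by auto
    then show ?thesis unfolding S_def by (intro sum_bounded_above) auto
  qed
  have r_bdd: "bdd_above ((\<lambda>X. a X + 2 * (rademacher b * h v X)) ` K)"
    if "bdd_above (a ` K)" for a :: "'x \<Rightarrow> real" and v b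
  proof (rule bdd_above_add_bounded[OF that])
    fix X assume "X \<in> K"
    then show "2 * (rademacher b * h v X) \<le> 2 * B" using h[of X v] by (auto simp: rademacher_def)
  qed
  have S_upd: "a X + (\<Sum>i\<in>insert x A. ?\<Lambda> X - l ((z(x := v)) i) X) = (a X + S z X) + (?\<Lambda> X - l v X)" for X z v
    using sum_insert_fun_upd[OF insert.hyps, of "\<lambda>u. ?\<Lambda> X - l u X" z v] by (simp add: S_def)
  have S'_upd: "a X + (\<Sum>i\<in>insert x A. 2 * (rademacher (snd ((y(x := v)) i)) * h (fst ((y(x := v)) i)) X)) =
      (a X + 2 * (rademacher (snd v) * h (fst v) X)) + S' y X" for X y v
    using sum_insert_fun_upd[OF insert.hyps, of "\<lambda>u. 2 * (rademacher (snd u) * h (fst u) X)" y v]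
    by (simp add: S'_def)
  have "measure_pmf.expectation (Pi_pmf (insert x A) dflt (\<lambda>_. p))
        (\<lambda>z. SUP X\<in>K. a X + (\<Sum>i\<in>insert x A. ?\<Lambda> X - l (z i) X))
      = ?E (\<lambda>z. measure_pmf.expectation p (\<lambda>v. SUP X\<in>K. (a X + S z X) + (?\<Lambda> X - l v X)))"
    by (simp only: expectation_Pi_pmf_insert(2)[OF insert.hyps fin] S_upd)
  also have "\<dots> \<le> ?E (\<lambda>z. measure_pmf.expectation p (\<lambda>v.
      ((SUP X\<in>K. (a X + S z X) + 2 * h v X) + (SUP X\<in>K. (a X + S z X) - 2 * h v X)) / 2))"
    by (intro expectation_mono_finite[OF finA] symmetrization_contraction_step[where B = B] fin K l h lip
        bdd_above_add_bounded[OF insert.prems S_bdd])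
  \<comment> \<open>The half-sum of the two suprema is the mean over a fair sign.\<close>
  also have "\<dots> = ?E (\<lambda>z. measure_pmf.expectation (with_rademacher p)
      (\<lambda>y. SUP X\<in>K. (a X + 2 * (rademacher (snd y) * h (fst y) X)) + S z X))"
    by (simp add: expectation_with_rademacher[OF fin] rademacher_def algebra_simps)
  also have "\<dots> = measure_pmf.expectation (with_rademacher p)
      (\<lambda>y. ?E (\<lambda>z. SUP X\<in>K. (a X + 2 * (rademacher (snd y) * h (fst y) X)) + S z X))"
    by (rule expectation_swap_finite[OF finA fin'])
  also have "\<dots> \<le> measure_pmf.expectation (with_rademacher p)
      (\<lambda>y. ?E' (\<lambda>y'. SUP X\<in>K. (a X + 2 * (rademacher (snd y) * h (fst y) X)) + S' y' X))"
    unfolding S_def S'_def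
    by (intro expectation_mono_finite[OF fin'] insert.IH r_bdd insert.prems)
  also have "\<dots> = measure_pmf.expectation (Pi_pmf (insert x A) dflt' (\<lambda>_. with_rademacher p))
      (\<lambda>y. SUP X\<in>K. a X + (\<Sum>i\<in>insert x A. 2 * (rademacher (snd (y i)) * h (fst (y i)) X)))"
    by (simp only: expectation_Pi_pmf_insert(1)[OF insert.hyps fin'] S'_upd)
  finally show ?case .
qed simp

section \<open>Maxima of Rademacher sums\<close>

text \<open>The tangent inequality \<open>x - u + 1 \<le> exp (x - u)\<close> takes the place of
  Jensen's inequality for the logarithm, and the exponential of the maximum is at most the sum of
  the exponentials.\<close>

lemma expectation_Max_le:
  fixes g :: "'s \<Rightarrow> 'a \<Rightarrow> real"
  assumes "finite (set_pmf p)" "finite S" "S \<noteq> {}" "l > 0"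
    "\<And>s. s \<in> S \<Longrightarrow> measure_pmf.expectation p (\<lambda>x. exp (l * g s x)) \<le> exp v"
  shows "measure_pmf.expectation p (\<lambda>x. Max ((\<lambda>s. g s x) ` S)) \<le> (ln (real (card S)) + v) / l"
proof -
  \<comment> \<open>For this \<open>u\<close> the sum of the moment bounds divided by
    \<open>exp u\<close> is 1, so the final estimate collapses to \<open>u\<close>.\<close>
  define u where "u = ln (real (card S)) + v"
  have eu: "exp u = real (card S) * exp v" using assms by (simp add: u_def exp_add card_gt_0_iff)
  have int: "integrable (measure_pmf p) f" for f :: "'a \<Rightarrow> real"
    by (rule integrable_measure_pmf_finite[OF assms(1)])
  have "l * measure_pmf.expectation p (\<lambda>x. Max ((\<lambda>s. g s x) ` S)) =
      measure_pmf.expectation p (\<lambda>x. l * Max ((\<lambda>s. g s x) ` S))" by simp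
  also have "\<dots> \<le> measure_pmf.expectation p (\<lambda>x. (\<Sum>s\<in>S. exp (l * g s x)) / exp u + (u - 1))"
  proof (rule expectation_mono_finite[OF assms(1)])
    fix x
    have "Max ((\<lambda>s. g s x) ` S) \<in> (\<lambda>s. g s x) ` S" using assms by (intro Max_in) auto
    then obtain s where s: "s \<in> S" "Max ((\<lambda>s. g s x) ` S) = g s x" by auto
    have "l * g s x - u + 1 \<le> exp (l * g s x - u)"
      using exp_ge_add_one_self[of "l * g s x - u"] by linarith
    also have "\<dots> = exp (l * g s x) / exp u" by (simp add: exp_diff)
    also have "\<dots> \<le> (\<Sum>s\<in>S. exp (l * g s x)) / exp u"
      using s(1) assms(2) by (intro divide_right_mono member_le_sum) auto
    finally show "l * Max ((\<lambda>s. g s x) ` S) \<le> (\<Sum>s\<in>S. exp (l * g s x)) / exp u + (u - 1)"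
      using s(2) by simp
  qed
  also have "\<dots> = (\<Sum>s\<in>S. measure_pmf.expectation p (\<lambda>x. exp (l * g s x))) / exp u + (u - 1)"
    by (simp add: int)
  also have "\<dots> \<le> (\<Sum>s\<in>S. exp v) / exp u + (u - 1)"
    by (intro add_right_mono divide_right_mono sum_mono assms) auto
  also have "\<dots> = u" using assms eu by (simp add: card_gt_0_iff)
  finally show ?thesis using assms(4) by (simp add: u_def pos_le_divide_eq mult.commute)
qed

lemma expectation_rademacher_sum:
  fixes g :: "'z \<Rightarrow> real"
  assumes "finite A" "finite (set_pmf p)"
  shows "measure_pmf.expectation (Pi_pmf A dflt (\<lambda>_. with_rademacher p))
    (\<lambda>y. \<Sum>i\<in>A. rademacher (snd (y i)) * g (fst (y i))) = 0"
proof -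
  let ?P = "Pi_pmf A dflt (\<lambda>_. with_rademacher p)"
  have "measure_pmf.expectation ?P (\<lambda>y. rademacher (snd (y i)) * g (fst (y i))) = 0" if "i \<in> A" for i
  proof -
    have "measure_pmf.expectation ?P (\<lambda>y. rademacher (snd (y i)) * g (fst (y i))) =
        measure_pmf.expectation (map_pmf (\<lambda>y. y i) ?P) (\<lambda>u. rademacher (snd u) * g (fst u))" by simp
    then show ?thesis using that assms
      by (simp only: Pi_pmf_component if_True expectation_with_rademacher) (simp add: rademacher_def)
  qed
  then show ?thesis using assms
    by (subst Bochner_Integration.integral_sum)
       (auto intro: integrable_measure_pmf_finite finite_set_Pi_pmf finite_set_with_rademacher)
qed

text \<open>The sum has mean 0 and changes by at most 2 with one signed sample, so bounded
  differences with \<open>c = 2\<close> apply.\<close>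

lemma rademacher_sum_mgf:
  fixes g :: "'z \<Rightarrow> real"
  assumes "finite A" "finite (set_pmf p)" "l > 0" "\<And>z. \<bar>g z\<bar> \<le> 1"
  shows "measure_pmf.expectation (Pi_pmf A dflt (\<lambda>_. with_rademacher p))
    (\<lambda>y. exp (l * (\<Sum>i\<in>A. rademacher (snd (y i)) * g (fst (y i))))) \<le> exp (2 * real (card A) * l\<^sup>2)"
proof -
  let ?F = "\<lambda>y. \<Sum>i\<in>A. rademacher (snd (y i)) * g (fst (y i))"
  have diff: "\<bar>?F (y(i := v)) - ?F (y(i := w))\<bar> \<le> 2" if "i \<in> A" for y i v w
  proof -
    have "?F (y(i := u)) = rademacher (snd u) * g (fst u) + (\<Sum>j\<in>A - {i}. rademacher (snd (y j)) * g (fst (y j)))" for u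
      using assms(1) that by (subst sum.remove[of _ i]) (auto intro!: sum.cong)
    moreover have "\<bar>rademacher (snd u) * g (fst u)\<bar> \<le> 1" for u
      using assms(4)[of "fst u"] by (auto simp: rademacher_def)
    then have "\<bar>rademacher (snd v) * g (fst v) - rademacher (snd w) * g (fst w)\<bar> \<le> 2"
      by (smt (verit))
    ultimately show ?thesis by simp
  qed
  show ?thesis
    using bounded_differences_mgf[OF assms(1) finite_set_with_rademacher[OF assms(2)] assms(3), of ?F 2 dflt, OF diff]
    by (simp add: expectation_rademacher_sum assms mult.commute mult.left_commute)
qed

section \<open>The link function\<close>

text \<open>For positive \<open>x\<close> the mean value theorem gives
  \<open>sin x = x * cos z\<close> with \<open>z\<close> below \<open>pi / 4\<close>, where the
  cosine is at least \<open>1 / sqrt 2\<close>; negative \<open>x\<close> follow by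
  symmetry.\<close>

lemma half_square_le_sin_square:
  fixes x :: real
  assumes "\<bar>x\<bar> \<le> pi / 4"
  shows "x\<^sup>2 / 2 \<le> (sin x)\<^sup>2"
proof -
  have pos: "x\<^sup>2 / 2 \<le> (sin x)\<^sup>2" if x: "0 < x" "x \<le> pi / 4" for x :: real
  proof -
    obtain z where z: "0 < z" "z < x" "sin x - sin 0 = (x - 0) * cos z"
      using MVT2[of 0 x sin cos] x by (auto intro: DERIV_sin)
    have "cos (pi / 4) \<le> cos z" using z x pi_ge_two by (intro cos_monotone_0_pi_le) auto
    then have "x * cos (pi / 4) \<le> sin x" using z x by simp
    then have "(x * cos (pi / 4))\<^sup>2 \<le> (sin x)\<^sup>2" using x by (intro power_mono) (auto simp: cos_45)
    then show ?thesis by (simp add: cos_45 power_mult_distrib power_divide)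
  qed
  show ?thesis
  proof (cases x "0 :: real" rule: linorder_cases)
    case less
    then show ?thesis using pos[of "-x"] assms by simp
  qed (use pos[of x] assms in auto)
qed

text \<open>The relative entropy of two Bernoulli laws, written with differences of log losses so
  that the expected excess loss unfolds to it.\<close>

definition kl_divergence_bits :: "real \<Rightarrow> real \<Rightarrow> real" where
  "kl_divergence_bits p q = p * (ln (1 / q) - ln (1 / p)) + (1 - p) * (ln (1 / (1 - q)) - ln (1 / (1 - p)))"

text \<open>This is \<open>ln s \<le> s - 1\<close> at \<open>s = sqrt (q / p)\<close>. Summed over
  both outcomes, the right-hand sides give the squared Hellinger distance.\<close>

lemma ln_diff_ge_sqrt:
  assumes "0 < p" "0 < q"
  shows "p * (ln (1 / q) - ln (1 / p)) \<ge> 2 * (p - sqrt p * sqrt q)"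
proof -
  define s where "s = sqrt (q / p)"
  have "ln s \<le> s - 1" using assms unfolding s_def by (intro ln_le_minus_one) auto
  moreover have "ln s = (ln q - ln p) / 2"
    using assms by (simp add: s_def ln_sqrt ln_div)
  ultimately have "2 - 2 * s \<le> ln p - ln q" by argo
  then have le: "p * (2 - 2 * s) \<le> p * (ln p - ln q)" using assms by (intro mult_left_mono) auto
  have "p / sqrt p = sqrt p" using assms by (intro real_div_sqrt) auto
  then have ps: "p * s = sqrt p * sqrt q"
    unfolding s_def real_sqrt_divide by (metis times_divide_eq_left times_divide_eq_right)
  have lns: "ln (1 / q) - ln (1 / p) = ln p - ln q" using assms by (simp add: ln_div)
  have "2 * (p - sqrt p * sqrt q) = p * (2 - 2 * s)"
    unfolding ps[symmetric] by (simp add: algebra_simps)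
  then show ?thesis unfolding lns using le by linarith
qed

text \<open>The relative entropy dominates the squared Hellinger distance, which is a chord of the unit
  circle; the angle \<open>arcsin \<circ> sqrt\<close> parametrizes the corresponding arc.\<close>

lemma kl_divergence_ge_angle:
  assumes "0 < p" "p < 1" "0 < q" "q < 1"
  shows "(arcsin (sqrt p) - arcsin (sqrt q))\<^sup>2 / 2 \<le> kl_divergence_bits p q"
proof -
  define D where "D = arcsin (sqrt p) - arcsin (sqrt q)"
  have lb: "-1 \<le> sqrt x" if "0 < x" for x using real_sqrt_ge_zero[of x] that by linarith
  have range: "0 \<le> arcsin (sqrt x) \<and> arcsin (sqrt x) \<le> pi / 2" if "0 < x" "x < 1" for x
    using that lb arcsin_bounded[of "sqrt x"] arcsin_le_arcsin[of 0 "sqrt x"] by auto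
  have circle: "sin (arcsin (sqrt x)) = sqrt x" "cos (arcsin (sqrt x)) = sqrt (1 - x)"
    if "0 < x" "x < 1" for x
    using that lb by (auto simp: cos_arcsin)
  have "D \<le> pi / 2" "- D \<le> pi / 2"
    using range[OF assms(1,2)] range[OF assms(3,4)] unfolding D_def by linarith+
  \<comment> \<open>Half the angle lies in the range of \<open>half_square_le_sin_square\<close>;
    the squared chord of the angle \<open>D\<close> is
    \<open>4 * (sin (D / 2))\<^sup>2\<close>.\<close>
  then have "\<bar>D / 2\<bar> \<le> pi / 4" by (intro abs_leI) linarith+
  then have "(D / 2)\<^sup>2 / 2 \<le> (sin (D / 2))\<^sup>2" by (rule half_square_le_sin_square)
  moreover have "(D / 2)\<^sup>2 = D\<^sup>2 / 4" by (simp add: power_divide)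
  ultimately have "D\<^sup>2 / 2 \<le> 4 * (sin (D / 2))\<^sup>2" by linarith
  also have "\<dots> = 2 - 2 * cos D"
    using cos_double_sin[of "D / 2"] by simp
  also have "cos D = sqrt (1 - p) * sqrt (1 - q) + sqrt p * sqrt q"
    using assms unfolding D_def by (simp add: cos_diff circle)
  also have "2 - 2 * (sqrt (1 - p) * sqrt (1 - q) + sqrt p * sqrt q) =
      2 * (p - sqrt p * sqrt q) + 2 * ((1 - p) - sqrt (1 - p) * sqrt (1 - q))"
    by (simp add: algebra_simps)
  also have "\<dots> \<le> kl_divergence_bits p q"
    unfolding kl_divergence_bits_def using assms by (intro add_mono ln_diff_ge_sqrt) auto
  finally show ?thesis by (simp add: D_def)
qed

lemma DERIV_ln_inverse:
  fixes h :: "real \<Rightarrow> real"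
  assumes "(h has_real_derivative D) (at z)" "0 < h z"
  shows "((\<lambda>x. ln (1 / h x)) has_real_derivative - (D / h z)) (at z)"
  using assms by (auto intro!: derivative_eq_intros simp: field_simps power2_eq_square)

section \<open>The loss of a single bit\<close>

locale link =
  fixes f :: "real \<Rightarrow> real" and \<alpha> :: real
  assumes admissible: "admissible_link f \<alpha>" and \<alpha>: "\<alpha> > 0"
begin

lemma differentiable: "f differentiable (at x)"
  using admissible by (simp add: admissible_link_def)

lemma f_deriv: "(f has_real_derivative deriv f x) (at x)"
  using differentiable by (simp add: DERIV_deriv_iff_real_differentiable)

lemma f_range: "0 \<le> f x" "f x \<le> 1"
  using admissible by (auto simp: admissible_link_def subset_iff)

lemma
  assumes "\<bar>x\<bar> \<le> \<alpha>"
  shows f_pos: "0 < f x" and f_less_1: "f x < 1" and deriv_nonzero: "deriv f x \<noteq> 0"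
proof -
  have x: "x \<in> {-\<alpha>..\<alpha>}" using assms by auto
  show d: "deriv f x \<noteq> 0" and "0 < f x"
    using admissible x f_range(1)[of x] by (force simp: admissible_link_def)+
  show "f x < 1"
  proof (rule ccontr)
    assume "\<not> f x < 1"
    then have "\<forall>y. \<bar>x - y\<bar> < 1 \<longrightarrow> f y \<le> f x" using f_range(2) by (meson linorder_not_less order_trans)
    then have "deriv f x = 0" using DERIV_local_max[OF f_deriv, of 1 x] by auto
    then show False using d by simp
  qed
qed

lemma L_ge: "\<bar>x\<bar> \<le> \<alpha> \<Longrightarrow> \<bar>deriv f x\<bar> / (f x * (1 - f x)) \<le> L_const f \<alpha>"
  and \<beta>_ge: "\<bar>x\<bar> \<le> \<alpha> \<Longrightarrow> f x * (1 - f x) / (deriv f x)\<^sup>2 \<le> \<beta>_const f \<alpha>"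
  and U_ge: "\<bar>x\<bar> \<le> \<alpha> \<Longrightarrow> ln (1 / (f x * (1 - f x))) \<le> U_const f \<alpha>"
  using admissible unfolding L_const_def \<beta>_const_def U_const_def admissible_link_def
  by (auto intro!: cSUP_upper)

lemma L_nonneg: "0 \<le> L_const f \<alpha>"
  using L_ge[of 0] \<alpha> f_pos[of 0] f_less_1[of 0]
  by (smt (verit) divide_nonneg_nonneg mult_nonneg_nonneg)

lemma \<beta>_pos: "0 < \<beta>_const f \<alpha>"
  using \<beta>_ge[of 0] \<alpha> f_pos[of 0] f_less_1[of 0] deriv_nonzero[of 0]
  by (smt (verit) divide_pos_pos mult_pos_pos zero_less_power2)

definition loss :: "int \<Rightarrow> real \<Rightarrow> real" where
  "loss y x = of_bool (y = 1) * ln (1 / f x) + of_bool (y = -1) * ln (1 / (1 - f x))"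

text \<open>The loss is one of two nonnegative logarithms or 0, and the sum of the two logarithms is
  the quantity bounded by \<open>U_const\<close>.\<close>

lemma loss_bounds:
  assumes "\<bar>x\<bar> \<le> \<alpha>"
  shows "0 \<le> loss y x" "loss y x \<le> U_const f \<alpha>"
proof -
  note f = f_pos[OF assms] f_less_1[OF assms]
  have "ln (1 / f x) \<ge> 0" "ln (1 / (1 - f x)) \<ge> 0" using f by (auto simp: ln_ge_zero)
  moreover have "ln (1 / f x) + ln (1 / (1 - f x)) = ln (1 / (f x * (1 - f x)))"
    using f by (simp add: ln_div ln_mult)
  ultimately show "0 \<le> loss y x" "loss y x \<le> U_const f \<alpha>"
    using U_ge[OF assms] by (auto simp: loss_def)
qed

lemma U_pos: "0 < U_const f \<alpha>"
proof -
  have f: "0 < f 0" "f 0 < 1" using f_pos[of 0] f_less_1[of 0] \<alpha> by auto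
  then have "f 0 * (1 - f 0) < 1 * 1" by (intro mult_strict_mono) auto
  then have "0 < ln (1 / (f 0 * (1 - f 0)))" using f by (intro ln_gt_zero) auto
  then show ?thesis using U_ge[of 0] \<alpha> by simp
qed

lemma MVT_between:
  fixes g :: "real \<Rightarrow> real"
  assumes "\<bar>x\<bar> \<le> \<alpha>" "\<bar>y\<bar> \<le> \<alpha>"
    "\<And>z. \<bar>z\<bar> \<le> \<alpha> \<Longrightarrow> (g has_real_derivative g' z) (at z)"
  shows "\<exists>z. \<bar>z\<bar> \<le> \<alpha> \<and> g x - g y = (x - y) * g' z"
proof (cases x y rule: linorder_cases)
  case less
  then obtain z where "x < z" "z < y" "g y - g x = (y - x) * g' z"
    using MVT2[of x y g g'] assms by auto
  then show ?thesis using assms(1,2) by (intro exI[of _ z]) (auto simp: algebra_simps)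
next
  case greater
  then obtain z where "y < z" "z < x" "g x - g y = (x - y) * g' z"
    using MVT2[of y x g g'] assms by auto
  then show ?thesis using assms(1,2) by (intro exI[of _ z]) auto
next
  case equal
  then show ?thesis using assms(1) by auto
qed

text \<open>The derivative of the loss is \<open>- f' / f\<close>, \<open>f' / (1 - f)\<close> or 0,
  depending on the bit. Inserting the missing factor, which is below 1, into the denominator bounds
  it by the ratio in \<open>L_const\<close>.\<close>

lemma loss_lipschitz:
  assumes "\<bar>x\<bar> \<le> \<alpha>" "\<bar>y\<bar> \<le> \<alpha>"
  shows "\<bar>loss b x - loss b y\<bar> \<le> L_const f \<alpha> * \<bar>x - y\<bar>"
proof -
  define g' where "g' z = - of_bool (b = 1) * (deriv f z / f z) + of_bool (b = -1) * (deriv f z / (1 - f z))" for z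
  have d: "(loss b has_real_derivative g' z) (at z)" if "\<bar>z\<bar> \<le> \<alpha>" for z
  proof -
    have "((\<lambda>x. 1 - f x) has_real_derivative - deriv f z) (at z)"
      by (auto intro!: derivative_eq_intros f_deriv)
    note DERIV_ln_inverse[OF f_deriv f_pos[OF that]] DERIV_ln_inverse[OF this]
    then show ?thesis unfolding loss_def g'_def using f_less_1[OF that]
      by (auto intro!: DERIV_cmult[THEN DERIV_cong] DERIV_add)
  qed
  obtain z where z: "\<bar>z\<bar> \<le> \<alpha>" "loss b x - loss b y = (x - y) * g' z"
    using MVT_between[OF assms, of "loss b" g'] d by auto
  note f = f_pos[OF z(1)] f_less_1[OF z(1)]
  have "\<bar>deriv f z\<bar> / f z \<le> \<bar>deriv f z\<bar> / (f z * (1 - f z))"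
    using f by (intro divide_left_mono) (auto simp: mult_le_cancel_left2)
  moreover have "\<bar>deriv f z\<bar> / (1 - f z) \<le> \<bar>deriv f z\<bar> / (f z * (1 - f z))"
    using f by (intro divide_left_mono) (auto simp: mult_le_cancel_right2)
  ultimately have "\<bar>g' z\<bar> \<le> L_const f \<alpha>"
    using L_ge[OF z(1)] f L_nonneg by (auto simp: g'_def abs_mult abs_divide)
  then show ?thesis using z(2) by (simp add: abs_mult mult.commute mult_right_mono)
qed

text \<open>The angle \<open>arcsin (sqrt (f z))\<close> has derivative
  \<open>f' / (2 * sqrt (f * (1 - f)))\<close>, whose square is at least
  \<open>1 / (4 * \<beta>_const f \<alpha>)\<close>. The mean value theorem thus bounds squared
  distances by \<open>4 * \<beta>_const f \<alpha>\<close> times squared angles, and a squared angle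
  is at most twice the relative entropy.\<close>

lemma square_le_kl:
  assumes "\<bar>x\<bar> \<le> \<alpha>" "\<bar>y\<bar> \<le> \<alpha>"
  shows "(x - y)\<^sup>2 \<le> 8 * \<beta>_const f \<alpha> * kl_divergence_bits (f x) (f y)"
proof -
  define g where "g z = arcsin (sqrt (f z))" for z
  define g' where "g' z = deriv f z / (2 * sqrt (f z) * sqrt (1 - f z))" for z
  have d: "(g has_real_derivative g' z) (at z)" if "\<bar>z\<bar> \<le> \<alpha>" for z
  proof -
    note f = f_pos[OF that] f_less_1[OF that]
    have "(g has_real_derivative inverse (sqrt (1 - (sqrt (f z))\<^sup>2)) * (inverse (sqrt (f z)) / 2 * deriv f z)) (at z)"
      unfolding g_def using f
      by (intro DERIV_chain2[where g = "\<lambda>z. sqrt (f z)" and f = arcsin] DERIV_arcsin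
          DERIV_chain2[where g = f and f = sqrt] DERIV_real_sqrt f_deriv) (auto intro: less_trans[of _ 0])
    then show ?thesis using f by (simp add: g'_def field_simps)
  qed
  obtain z where z: "\<bar>z\<bar> \<le> \<alpha>" "g x - g y = (x - y) * g' z"
    using MVT_between[OF assms, of g g'] d by auto
  note f = f_pos[OF z(1)] f_less_1[OF z(1)] deriv_nonzero[OF z(1)]
  have "1 / (4 * \<beta>_const f \<alpha>) \<le> (g' z)\<^sup>2"
  proof -
    have "(g' z)\<^sup>2 = (deriv f z)\<^sup>2 / (4 * (f z * (1 - f z)))"
      using f by (simp add: g'_def power_divide power_mult_distrib)
    moreover have "f z * (1 - f z) \<le> \<beta>_const f \<alpha> * (deriv f z)\<^sup>2"
      using \<beta>_ge[OF z(1)] f by (simp add: divide_le_eq)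
    moreover have "1 / (4 * b) \<le> c / (4 * a)" if "0 < a" "0 < b" "a \<le> b * c" for a b c :: real
      using that by (simp add: field_simps)
    ultimately show ?thesis using f \<beta>_pos by (simp only: mult_pos_pos diff_gt_0_iff_gt)
  qed
  then have "(x - y)\<^sup>2 * (1 / (4 * \<beta>_const f \<alpha>)) \<le> (x - y)\<^sup>2 * (g' z)\<^sup>2"
    by (intro mult_left_mono) auto
  also have "\<dots> = (g x - g y)\<^sup>2" by (simp add: z(2) power_mult_distrib)
  also have "\<dots> \<le> 2 * kl_divergence_bits (f x) (f y)"
    using kl_divergence_ge_angle[of "f x" "f y"] f_pos f_less_1 assms by (simp add: g_def)
  finally show ?thesis using \<beta>_pos by (simp add: field_simps)
qed

end

section \<open>Recovery from one-bit measurements\<close>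

definition labelled_pmf :: "index pmf \<Rightarrow> (real \<Rightarrow> real) \<Rightarrow> tensor \<Rightarrow> (index \<times> int) pmf" where
  "labelled_pmf \<pi> f T = bind_pmf \<pi> (\<lambda>w. map_pmf (Pair w) (bit_pmf (f (T w))))"

text \<open>Drawing all indices first and then all bits amounts to drawing independent labelled
  samples, which makes the product-law results applicable. The default \<open>(undefined, 0)\<close>
  pairs the dummy index with the dummy bit.\<close>

lemma observations_iid:
  "map_pmf (\<lambda>(w, Y) i. (w i, Y i)) (observations m \<pi> f T) =
    Pi_pmf {1..m} (undefined, 0) (\<lambda>_. labelled_pmf \<pi> f T)"
proof -
  let ?A = "{1..m}"
  let ?g = "\<lambda>w i. bit_pmf (f (T (w i)))"
  have inner: "Pi_pmf ?A (undefined, 0) (\<lambda>i. map_pmf (Pair (w i)) (?g w i)) =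
      map_pmf (\<lambda>Y i. (w i, Y i)) (Pi_pmf ?A 0 (?g w))"
    if w: "w \<in> set_pmf (Pi_pmf ?A undefined (\<lambda>_. \<pi>))" for w
  proof -
    have out: "w i = undefined" if "i \<notin> ?A" for i
      using w that set_Pi_pmf_subset[of ?A undefined "\<lambda>_. \<pi>"] by auto
    have "Pi_pmf ?A (undefined, 0) (\<lambda>i. map_pmf (Pair (w i)) (?g w i)) =
        bind_pmf (Pi_pmf ?A 0 (?g w)) (\<lambda>Y. Pi_pmf ?A (undefined, 0) (\<lambda>i. return_pmf (w i, Y i)))"
      unfolding map_pmf_def by (rule Pi_pmf_bind) simp
    also have "\<dots> = bind_pmf (Pi_pmf ?A 0 (?g w)) (\<lambda>Y. return_pmf (\<lambda>i. (w i, Y i)))"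
    proof (rule bind_pmf_cong[OF refl])
      fix Y assume "Y \<in> set_pmf (Pi_pmf ?A 0 (?g w))"
      then have "Y i = 0" if "i \<notin> ?A" for i
        using that set_Pi_pmf_subset[of ?A 0 "?g w"] by auto
      then have "(\<lambda>i. if i \<in> ?A then (w i, Y i) else (undefined, 0)) = (\<lambda>i. (w i, Y i))"
        using out by (intro ext) simp
      then show "Pi_pmf ?A (undefined, 0) (\<lambda>i. return_pmf (w i, Y i)) = return_pmf (\<lambda>i. (w i, Y i))"
        by simp
    qed
    finally show ?thesis by (simp add: map_pmf_def)
  qed
  have "Pi_pmf ?A (undefined, 0) (\<lambda>_. labelled_pmf \<pi> f T) =
      bind_pmf (Pi_pmf ?A undefined (\<lambda>_. \<pi>)) (\<lambda>w. Pi_pmf ?A (undefined, 0) (\<lambda>i. map_pmf (Pair (w i)) (?g w i)))"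
    unfolding labelled_pmf_def by (rule Pi_pmf_bind) simp
  also have "\<dots> = bind_pmf (Pi_pmf ?A undefined (\<lambda>_. \<pi>)) (\<lambda>w. map_pmf (\<lambda>Y i. (w i, Y i)) (Pi_pmf ?A 0 (?g w)))"
    by (rule bind_pmf_cong[OF refl inner])
  also have "\<dots> = map_pmf (\<lambda>(w, Y) i. (w i, Y i)) (observations m \<pi> f T)"
    by (simp add: observations_def map_bind_pmf pmf.map_comp o_def)
  finally show ?thesis ..
qed

lemma finite_set_bit_pmf: "finite (set_pmf (bit_pmf q))"
  by (simp add: bit_pmf_def)

lemma expectation_bit_pmf:
  fixes g :: "int \<Rightarrow> real"
  assumes "0 \<le> q" "q \<le> 1"
  shows "measure_pmf.expectation (bit_pmf q) g = q * g 1 + (1 - q) * g (-1)"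
  using assms by (simp add: bit_pmf_def mult.commute)

lemma finite_set_labelled_pmf: "finite (set_pmf \<pi>) \<Longrightarrow> finite (set_pmf (labelled_pmf \<pi> f T))"
  by (simp add: labelled_pmf_def finite_set_bit_pmf)

lemma expectation_rademacher_sign_tensors:
  fixes p :: "(index \<times> int) pmf"
  assumes "N \<ge> 1" "d \<ge> 1" "m \<ge> 1" "finite (set_pmf p)"
  shows "measure_pmf.expectation (Pi_pmf {1..m} dflt (\<lambda>_. with_rademacher p))
      (\<lambda>y. Max ((\<lambda>S. \<Sum>i=1..m. rademacher (snd (y i)) * S (fst (fst (y i)))) ` sign_tensors d N))
    \<le> 3 * sqrt (real m * real d * real N)"
proof -
  let ?S = "sign_tensors d N"
  define a where "a = real d * real N"
  \<comment> \<open>With this \<open>l\<close> the moment exponent is \<open>2 * a\<close>, while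
    the logarithm of the number of sign tensors is at most \<open>a\<close>; the total is
    \<open>3 * a / l = 3 * sqrt (m * a)\<close>.\<close>
  define l where "l = sqrt (a / real m)"
  have a: "a > 0" using assms by (simp add: a_def)
  have m: "real m > 0" using assms by simp
  have l: "l > 0" using a m by (simp add: l_def)
  have S: "finite ?S" "card ?S \<le> 2 ^ (d * N)" "?S \<noteq> {}"
    using finite_card_sign_tensors sign_tensors_nonempty[OF assms(1)] by auto
  have "measure_pmf.expectation (Pi_pmf {1..m} dflt (\<lambda>_. with_rademacher p))
      (\<lambda>y. Max ((\<lambda>S. \<Sum>i=1..m. rademacher (snd (y i)) * S (fst (fst (y i)))) ` ?S))
      \<le> (ln (real (card ?S)) + 2 * real m * l\<^sup>2) / l"
  proof (rule expectation_Max_le[OF _ S(1,3) l])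
    show "finite (set_pmf (Pi_pmf {1..m} dflt (\<lambda>_. with_rademacher p)))"
      by (intro finite_set_Pi_pmf finite_set_with_rademacher assms) simp
    fix S assume "S \<in> ?S"
    then show "measure_pmf.expectation (Pi_pmf {1..m} dflt (\<lambda>_. with_rademacher p))
        (\<lambda>y. exp (l * (\<Sum>i=1..m. rademacher (snd (y i)) * S (fst (fst (y i)))))) \<le> exp (2 * real m * l\<^sup>2)"
      using rademacher_sum_mgf[of "{1..m}" p l "\<lambda>z. S (fst z)" dflt] assms(4) l
      by (simp add: sign_tensors_abs_le)
  qed
  also have "\<dots> \<le> (a + 2 * a) / l"
  proof (intro divide_right_mono add_mono)
    have "ln (real (card ?S)) \<le> ln (2 ^ (d * N))"
      using S by (subst ln_le_cancel_iff) (auto simp: card_gt_0_iff simp flip: of_nat_power)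
    also have "\<dots> = a * ln 2" by (simp add: ln_realpow a_def)
    also have "\<dots> \<le> a * 1" using a ln_2_less_1 by (intro mult_left_mono) auto
    finally show "ln (real (card ?S)) \<le> a" by simp
    show "2 * real m * l\<^sup>2 \<le> 2 * a" using a m by (simp add: l_def)
  qed (use l in auto)
  also have "\<dots> = 3 * (a / l)" by simp
  also have "a / l = sqrt (real m * a)"
  proof -
    have "sqrt (real m * a) * l = a"
      using a m by (simp add: l_def real_sqrt_mult real_sqrt_divide)
    then show ?thesis using l by (simp add: field_simps)
  qed
  finally show ?thesis by (simp add: a_def mult.assoc)
qed

section \<open>Excess loss and uniform deviation\<close>

context link
begin

definition excess :: "tensor \<Rightarrow> index \<times> int \<Rightarrow> tensor \<Rightarrow> real" where
  "excess T z X = loss (snd z) (X (fst z)) - loss (snd z) (T (fst z))"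

text \<open>Given the index, the bit is 1 with probability \<open>f (T \<xi>)\<close>, so the
  conditional mean of the excess is a relative entropy.\<close>

lemma expected_excess:
  assumes "set_pmf \<pi> \<subseteq> indices d N" "\<And>\<xi>. \<bar>T \<xi>\<bar> \<le> \<alpha>" "\<And>\<xi>. \<bar>X \<xi>\<bar> \<le> \<alpha>"
  shows "measure_pmf.expectation (labelled_pmf \<pi> f T) (\<lambda>z. excess T z X) =
    (\<Sum>\<xi>\<in>indices d N. pmf \<pi> \<xi> * kl_divergence_bits (f (T \<xi>)) (f (X \<xi>)))"
proof -
  have fin: "finite (set_pmf \<pi>)" by (rule finite_subset[OF assms(1) finite_indices])
  have "measure_pmf.expectation (labelled_pmf \<pi> f T) (\<lambda>z. excess T z X) =
      measure_pmf.expectation \<pi> (\<lambda>\<xi>. measure_pmf.expectation (bit_pmf (f (T \<xi>))) (\<lambda>y. excess T (\<xi>, y) X))"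
    unfolding labelled_pmf_def using fin finite_set_bit_pmf
    by (subst expectation_bind_finite) auto
  also have "\<dots> = measure_pmf.expectation \<pi> (\<lambda>\<xi>. kl_divergence_bits (f (T \<xi>)) (f (X \<xi>)))"
    by (simp add: expectation_bit_pmf f_range excess_def loss_def kl_divergence_bits_def)
  also have "\<dots> = (\<Sum>\<xi>\<in>indices d N. pmf \<pi> \<xi> * kl_divergence_bits (f (T \<xi>)) (f (X \<xi>)))"
    using assms(1) by (subst integral_measure_pmf[of "indices d N"]) auto
  finally show ?thesis .
qed

lemma weighted_norm_le_expected_excess:
  assumes "set_pmf \<pi> \<subseteq> indices d N" "\<And>\<xi>. \<bar>T \<xi>\<bar> \<le> \<alpha>" "\<And>\<xi>. \<bar>X \<xi>\<bar> \<le> \<alpha>"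
  shows "(weighted_norm d N \<pi> (T - X))\<^sup>2 \<le>
    8 * \<beta>_const f \<alpha> * measure_pmf.expectation (labelled_pmf \<pi> f T) (\<lambda>z. excess T z X)"
proof -
  have "(weighted_norm d N \<pi> (T - X))\<^sup>2 = (\<Sum>\<xi>\<in>indices d N. pmf \<pi> \<xi> * (T \<xi> - X \<xi>)\<^sup>2)"
    by (simp add: weighted_norm_def sum_nonneg)
  also have "\<dots> \<le> (\<Sum>\<xi>\<in>indices d N. pmf \<pi> \<xi> * (8 * \<beta>_const f \<alpha> * kl_divergence_bits (f (T \<xi>)) (f (X \<xi>))))"
    by (intro sum_mono mult_left_mono square_le_kl assms(2,3)) auto
  also have "\<dots> = 8 * \<beta>_const f \<alpha> * (\<Sum>\<xi>\<in>indices d N. pmf \<pi> \<xi> * kl_divergence_bits (f (T \<xi>)) (f (X \<xi>)))"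
    by (simp add: sum_distrib_left mult.left_commute)
  finally show ?thesis by (simp add: expected_excess[OF assms])
qed

lemma neg_log_likelihood_diff:
  "neg_log_likelihood m f w Y X - neg_log_likelihood m f w Y T = (\<Sum>i=1..m. excess T (w i, Y i) X)"
  unfolding neg_log_likelihood_def excess_def loss_def fst_conv snd_conv sum_subtractf[symmetric] ..

text \<open>A general \<open>K\<close> covers both estimators. The deviation bound is uniform over
  \<open>K\<close> and thus holds for all minimizers at once. The factor 48 is 8 from
  \<open>square_le_kl\<close> times 6, which is 2 from symmetrization times 3 from the Rademacher
  maximum.\<close>

lemma recovery_bound:
  assumes "N \<ge> 1" "d \<ge> 1" "m \<ge> 1" and \<pi>: "set_pmf \<pi> \<subseteq> indices d N"
    and T: "T \<in> K" and K: "K \<subseteq> K_M d N \<alpha> R" and \<delta>: "0 < \<delta>" "\<delta> < 1"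
  shows "measure_pmf.prob (observations m \<pi> f T)
      {(w, Y). \<forall>X. is_arg_min (neg_log_likelihood m f w Y) (\<lambda>X. X \<in> K) X \<longrightarrow>
        (weighted_norm d N \<pi> (T - X))\<^sup>2 \<le>
          48 * \<beta>_const f \<alpha> * (L_const f \<alpha> * R * sqrt (real d * real N / real m)
            + U_const f \<alpha> * sqrt (ln (4 / \<delta>) / real m))} \<ge> 1 - \<delta>"
    (is "measure_pmf.prob _ ?good \<ge> _")
proof -
  let ?L = "L_const f \<alpha>" and ?U = "U_const f \<alpha>" and ?\<beta> = "\<beta>_const f \<alpha>"
  define p where "p = labelled_pmf \<pi> f T"
  define \<Lambda> where "\<Lambda> X = measure_pmf.expectation p (\<lambda>z. excess T z X)" for X
  \<comment> \<open>The largest deviation of the mean from the empirical excess, summed over the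
    samples; the summand 0 is the offset of \<open>symmetrization_contraction\<close>.\<close>
  define F where "F z = (SUP X\<in>K. 0 + (\<Sum>i=1..m. \<Lambda> X - excess T (z i) X))" for z
  let ?P = "Pi_pmf {1..m} (undefined, 0) (\<lambda>_. p)"
  \<comment> \<open>The loss is \<open>?L\<close>-Lipschitz in the entry, hence a contraction
    relative to this linear function of the tensor.\<close>
  define h where "h z X = ?L * X (fst z)" for z :: "index \<times> int" and X :: tensor
  have fin: "finite (set_pmf p)"
    unfolding p_def by (intro finite_set_labelled_pmf finite_subset[OF \<pi> finite_indices])
  have K0: "K \<noteq> {}" using T by auto
  have tens: "X \<in> tensors d N" and Mn: "M_norm d N X \<le> R" and bd: "\<bar>X \<xi>\<bar> \<le> \<alpha>" if "X \<in> K" for X \<xi>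
    using that K tensor_abs_le[of X d N \<alpha> \<xi>] \<alpha> by (auto simp: K_M_def)
  have exc: "\<bar>excess T z X\<bar> \<le> ?U" if "X \<in> K" for z X
    unfolding excess_def
    using loss_bounds[OF bd[OF that], of "snd z" "fst z"] loss_bounds[OF bd[OF T], of "snd z" "fst z"] by linarith
  have hb: "\<bar>h z X\<bar> \<le> ?L * \<alpha>" if "X \<in> K" for z X
    using bd[OF that, of "fst z"] L_nonneg by (simp add: h_def abs_mult mult_left_mono)
  have lip: "\<bar>excess T z X - excess T z X'\<bar> \<le> \<bar>h z X - h z X'\<bar>" if "X \<in> K" "X' \<in> K" for z X X'
    using loss_lipschitz[OF bd[OF that(1)] bd[OF that(2)], of "snd z" "fst z" "fst z"] L_nonneg
    by (simp add: excess_def h_def abs_mult flip: right_diff_distrib)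
  have \<Lambda>b: "\<bar>\<Lambda> X\<bar> \<le> ?U" if "X \<in> K" for X
    unfolding \<Lambda>_def using exc[OF that] by (intro abs_expectation_le fin)
  have bdd0: "bdd_above ((\<lambda>X. 0 :: real) ` K)" by (rule bdd_aboveI[of _ 0]) auto
  have bddF: "bdd_above ((\<lambda>X. 0 + (\<Sum>i=1..m. \<Lambda> X - excess T (z i) X)) ` K)" for z
  proof (rule bdd_above_add_bounded[OF bdd0])
    fix X assume X: "X \<in> K"
    have "\<Lambda> X - excess T (z i) X \<le> 2 * ?U" for i using exc[OF X, of "z i"] \<Lambda>b[OF X] by linarith
    then show "(\<Sum>i=1..m. \<Lambda> X - excess T (z i) X) \<le> real (card {1..m}) * (2 * ?U)"
      by (intro sum_bounded_above) auto
  qed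
  define B where "B = ?U + ?L * \<alpha>"
  define M where "M y = Max ((\<lambda>S. \<Sum>i=1..m. rademacher (snd (y i)) * S (fst (fst (y i)))) ` sign_tensors d N)"
    for y :: "nat \<Rightarrow> (index \<times> int) \<times> bool"
  let ?P' = "Pi_pmf {1..m} undefined (\<lambda>_. with_rademacher p)"
  have "measure_pmf.expectation ?P F \<le> measure_pmf.expectation ?P'
      (\<lambda>y. SUP X\<in>K. 0 + (\<Sum>i=1..m. 2 * (rademacher (snd (y i)) * h (fst (y i)) X)))"
    unfolding F_def \<Lambda>_def
  proof (rule symmetrization_contraction[OF _ fin K0 bdd0, where B = B])
    show "\<bar>excess T z X\<bar> \<le> B" if "X \<in> K" for z X
      using exc[OF that, of z] L_nonneg \<alpha> by (auto simp: B_def intro: add_increasing2)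
    show "\<bar>h z X\<bar> \<le> B" if "X \<in> K" for z X
      using hb[OF that, of z] U_pos by (simp add: B_def)
  qed (use lip in auto)
  also have "\<dots> \<le> measure_pmf.expectation ?P' (\<lambda>y. 2 * ?L * R * M y)"
  proof (rule expectation_mono_finite, goal_cases)
    case 1
    show ?case by (intro finite_set_Pi_pmf finite_set_with_rademacher fin) simp
  next
    case (2 y)
    show ?case
    proof (rule cSUP_least[OF K0])
      fix X assume X: "X \<in> K"
      \<comment> \<open>For fixed samples and signs the Rademacher sum is linear in the tensor, so
        the sign tensors control it on the M-ball.\<close>
      let ?g = "\<lambda>X :: tensor. \<Sum>i=1..m. rademacher (snd (y i)) * X (fst (fst (y i)))"
      have "?g X \<le> R * M y"
      proof (rule linear_bound_on_M_ball[OF assms(1,2) tens[OF X] Mn[OF X]])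
        show "?g (a *\<^sub>R x + b *\<^sub>R x') = a * ?g x + b * ?g x'" for x x' a b
          by (simp add: scaleR_fun_def sum_distrib_left sum.distrib algebra_simps)
        show "?g S \<le> M y" if "S \<in> sign_tensors d N" for S
          unfolding M_def using finite_card_sign_tensors that by (intro Max_ge) auto
      qed
      then have "2 * ?L * ?g X \<le> 2 * ?L * (R * M y)" using L_nonneg by (intro mult_left_mono) auto
      then show "0 + (\<Sum>i=1..m. 2 * (rademacher (snd (y i)) * h (fst (y i)) X)) \<le> 2 * ?L * R * M y"
        by (simp add: h_def sum_distrib_left algebra_simps)
    qed
  qed
  also have "\<dots> = 2 * ?L * R * measure_pmf.expectation ?P' M" by simp
  also have "\<dots> \<le> 2 * ?L * R * (3 * sqrt (real m * real d * real N))"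
  proof (rule mult_left_mono)
    show "measure_pmf.expectation ?P' M \<le> 3 * sqrt (real m * real d * real N)"
      unfolding M_def by (rule expectation_rademacher_sign_tensors[OF assms(1-3) fin])
    \<comment> \<open>The radius is nonnegative since the M-norm of \<open>T\<close> is an infimum
      over a nonempty set of positive numbers.\<close>
    obtain t where "t > 0" "T \<in> (*\<^sub>R) t ` (convex hull sign_tensors d N)"
      using tensor_in_scaled_hull[OF assms(1,2) tens[OF T]] by auto
    then have "0 \<le> M_norm d N T" unfolding M_norm_def by (intro cInf_greatest) auto
    then show "0 \<le> 2 * ?L * R" using Mn[OF T] L_nonneg by simp
  qed
  finally have EF: "measure_pmf.expectation ?P F \<le> 6 * ?L * R * sqrt (real m * real d * real N)" by simp

  \<comment> \<open>Each sample enters a sum through one excess of absolute value at most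
    \<open>?U\<close>, so every sum, and with it the supremum, moves by at most
    \<open>2 * ?U\<close>.\<close>
  have Fdiff: "\<bar>F (z(i := v)) - F (z(i := w))\<bar> \<le> 2 * ?U" if i: "i \<in> {1..m}" for z i v w
  proof -
    have le: "F (z(i := v)) \<le> F (z(i := w)) + 2 * ?U" for v w
      unfolding F_def
    proof (rule cSUP_least[OF K0])
      fix X assume X: "X \<in> K"
      have sum_i: "(\<Sum>j=1..m. \<Lambda> X - excess T ((z(i := u)) j) X) =
          (\<Lambda> X - excess T u X) + (\<Sum>j\<in>{1..m} - {i}. \<Lambda> X - excess T (z j) X)" for u
        using i by (subst sum.remove[of _ i]) (auto intro!: sum.cong)
      have "(\<Sum>j=1..m. \<Lambda> X - excess T ((z(i := v)) j) X) \<le>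
          (\<Sum>j=1..m. \<Lambda> X - excess T ((z(i := w)) j) X) + 2 * ?U"
        unfolding sum_i using exc[OF X, of v] exc[OF X, of w] by linarith
      moreover have "0 + (\<Sum>j=1..m. \<Lambda> X - excess T ((z(i := w)) j) X) \<le>
          (SUP X\<in>K. 0 + (\<Sum>j=1..m. \<Lambda> X - excess T ((z(i := w)) j) X))"
        by (rule cSUP_upper[OF X bddF])
      ultimately show "0 + (\<Sum>j=1..m. \<Lambda> X - excess T ((z(i := v)) j) X) \<le>
          (SUP X\<in>K. 0 + (\<Sum>j=1..m. \<Lambda> X - excess T ((z(i := w)) j) X)) + 2 * ?U" by linarith
    qed
    show ?thesis using le[of v w] le[of w v] by linarith
  qed
  define t where "t = 2 * ?U * sqrt (2 * real m * ln (1 / \<delta>))"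
  have tail: "measure_pmf.prob ?P {z. F z \<le> measure_pmf.expectation ?P F + t} \<ge> 1 - \<delta>"
    using bounded_differences_tail[OF _ _ fin _ \<delta>, of "{1..m}" "2 * ?U" F "(undefined, 0)"] Fdiff U_pos assms(3)
    by (simp add: t_def)
  have "(\<lambda>(w, Y) i. (w i, Y i)) -` {z. F z \<le> measure_pmf.expectation ?P F + t} \<subseteq> ?good"
  proof safe
    fix w :: "nat \<Rightarrow> index" and Y :: "nat \<Rightarrow> int" and X
    assume F: "F (\<lambda>i. (w i, Y i)) \<le> measure_pmf.expectation ?P F + t"
      and min: "is_arg_min (neg_log_likelihood m f w Y) (\<lambda>X. X \<in> K) X"
    have X: "X \<in> K" and "neg_log_likelihood m f w Y X \<le> neg_log_likelihood m f w Y T"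
      using min T by (auto simp: is_arg_min_linorder)
    \<comment> \<open>\<open>T\<close> competes in the minimization, so the empirical excess is
      nonpositive and the mean excess is at most the deviation.\<close>
    then have "(\<Sum>i=1..m. excess T (w i, Y i) X) \<le> 0"
      using neg_log_likelihood_diff[of m w Y X T] by linarith
    then have "real m * \<Lambda> X \<le> 0 + (\<Sum>i=1..m. \<Lambda> X - excess T (w i, Y i) X)"
      by (simp add: sum_subtractf)
    also have "\<dots> \<le> F (\<lambda>i. (w i, Y i))"
      unfolding F_def using cSUP_upper[OF X bddF[of "\<lambda>i. (w i, Y i)"]] by simp
    also have "\<dots> \<le> 6 * ?L * R * sqrt (real m * real d * real N) + t" using F EF by linarith
    also have "\<dots> = real m * (6 * ?L * R * sqrt (real d * real N / real m) + 2 * ?U * sqrt (2 * ln (1 / \<delta>) / real m))"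
    proof -
      have "sqrt (real m * x) = real m * sqrt (x / real m)" for x
      proof -
        have "real m * sqrt (x / real m) = sqrt (real m ^ 2) * sqrt (x / real m)" by simp
        also have "\<dots> = sqrt (real m * x)"
          unfolding real_sqrt_mult[symmetric] using assms(3) by (simp add: power2_eq_square)
        finally show ?thesis ..
      qed
      from this[of "real d * real N"] this[of "2 * ln (1 / \<delta>)"] show ?thesis
        by (simp add: t_def algebra_simps)
    qed
    finally have \<Lambda>: "\<Lambda> X \<le> 6 * ?L * R * sqrt (real d * real N / real m) + 2 * ?U * sqrt (2 * ln (1 / \<delta>) / real m)"
      using assms(3) by simp
    \<comment> \<open>Enlarges the deviation term to the common factor 6 and to
      \<open>ln (4 / \<delta>)\<close>, using 8 <= 36.\<close>
    have "2 * sqrt (2 * ln (1 / \<delta>) / real m) = sqrt (8 * ln (1 / \<delta>) / real m)"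
      using real_sqrt_mult[of 4 "2 * ln (1 / \<delta>) / real m"] by simp
    also have "\<dots> \<le> sqrt (36 * ln (4 / \<delta>) / real m)"
    proof (intro real_sqrt_le_mono divide_right_mono mult_mono)
      show "ln (1 / \<delta>) \<le> ln (4 / \<delta>)" using \<delta> by (subst ln_le_cancel_iff) (auto simp: divide_right_mono)
    qed (use \<delta> in auto)
    also have "\<dots> = 6 * sqrt (ln (4 / \<delta>) / real m)"
      using real_sqrt_mult[of 36 "ln (4 / \<delta>) / real m"] by simp
    finally have "?U * (2 * sqrt (2 * ln (1 / \<delta>) / real m)) \<le> ?U * (6 * sqrt (ln (4 / \<delta>) / real m))"
      using U_pos by (intro mult_left_mono) auto
    then have "\<Lambda> X \<le> 6 * (?L * R * sqrt (real d * real N / real m) + ?U * sqrt (ln (4 / \<delta>) / real m))"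
      using \<Lambda> by (simp add: algebra_simps)
    then have "8 * ?\<beta> * \<Lambda> X \<le> 8 * ?\<beta> * (6 * (?L * R * sqrt (real d * real N / real m) + ?U * sqrt (ln (4 / \<delta>) / real m)))"
      using \<beta>_pos by (intro mult_left_mono) auto
    moreover have "(weighted_norm d N \<pi> (T - X))\<^sup>2 \<le> 8 * ?\<beta> * \<Lambda> X"
      unfolding \<Lambda>_def p_def by (rule weighted_norm_le_expected_excess[OF \<pi>]) (use bd T X in auto)
    ultimately show "(weighted_norm d N \<pi> (T - X))\<^sup>2 \<le>
        48 * ?\<beta> * (?L * R * sqrt (real d * real N / real m) + ?U * sqrt (ln (4 / \<delta>) / real m))"
      by linarith
  qed
  then have "measure_pmf.prob (map_pmf (\<lambda>(w, Y) i. (w i, Y i)) (observations m \<pi> f T))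
        {z. F z \<le> measure_pmf.expectation ?P F + t} \<le> measure_pmf.prob (observations m \<pi> f T) ?good"
    unfolding measure_map_pmf by (intro measure_pmf.finite_measure_mono) auto
  then show ?thesis using tail unfolding observations_iid p_def[symmetric] by linarith
qed

end

section \<open>The two estimators\<close>

theorem corollary4:
  fixes c1 c2 :: real
  assumes "grothendieck_constants c1 c2"
  shows "\<exists>C_max C_M :: real.
    \<forall>(d::nat) (N::nat) (r::nat) (m::nat) (\<alpha>::real) (f :: real \<Rightarrow> real) (\<pi> :: index pmf) (T :: tensor).
      d \<ge> 2 \<and> N \<ge> 1 \<and> r \<ge> 1 \<and> \<alpha> > 0 \<and> admissible_link f \<alpha> \<and>
      T \<in> tensors d N \<and> cp_rank d N T = r \<and> tensor_inf_norm d N T \<le> \<alpha> \<and>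
      2 \<le> m \<and> m \<le> N ^ d \<and> set_pmf \<pi> \<subseteq> indices d N \<longrightarrow>
      (\<forall>\<delta>::real. 0 < \<delta> \<and> \<delta> < 1 \<longrightarrow>
        (let R_max = sqrt (real r ^ (d\<^sup>2 - d)) * \<alpha> in
           max_qnorm d N T \<le> R_max \<and>
           measure_pmf.prob (observations m \<pi> f T)
             {(\<omega>, Y). \<forall>X. is_arg_min (neg_log_likelihood m f \<omega> Y) (\<lambda>X. X \<in> K_max d N \<alpha> R_max) X \<longrightarrow>
                (weighted_norm d N \<pi> (T - X))\<^sup>2 \<le>
                  C_max * c2 ^ d * \<beta>_const f \<alpha> *
                    (L_const f \<alpha> * R_max * sqrt (real d * real N / real m)
                     + U_const f \<alpha> * sqrt (ln (4 / \<delta>) / real m))}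
             \<ge> 1 - \<delta>) \<and>
        (let R_M = (real r * sqrt (real r)) ^ (d - 1) * \<alpha> in
           M_norm d N T \<le> R_M \<and>
           measure_pmf.prob (observations m \<pi> f T)
             {(\<omega>, Y). \<forall>X. is_arg_min (neg_log_likelihood m f \<omega> Y) (\<lambda>X. X \<in> K_M d N \<alpha> R_M) X \<longrightarrow>
                (weighted_norm d N \<pi> (T - X))\<^sup>2 \<le>
                  C_M * \<beta>_const f \<alpha> *
                    (L_const f \<alpha> * R_M * sqrt (real d * real N / real m)
                     + U_const f \<alpha> * sqrt (ln (4 / \<delta>) / real m))}
             \<ge> 1 - \<delta>))"
\<comment> \<open>\<open>c1\<close> is a fixed number and goes into \<open>C_max\<close>, whereas
  \<open>c2 ^ d\<close> varies with \<open>d\<close> and stays in the bound.\<close>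
proof (rule exI[of _ "48 * c1"], rule exI[of _ 48], intro allI impI)
  fix d N r m :: nat and \<alpha> :: real and f :: "real \<Rightarrow> real" and \<pi> :: "index pmf" and T :: tensor and \<delta> :: real
  assume A: "d \<ge> 2 \<and> N \<ge> 1 \<and> r \<ge> 1 \<and> \<alpha> > 0 \<and> admissible_link f \<alpha> \<and>
      T \<in> tensors d N \<and> cp_rank d N T = r \<and> tensor_inf_norm d N T \<le> \<alpha> \<and>
      2 \<le> m \<and> m \<le> N ^ d \<and> set_pmf \<pi> \<subseteq> indices d N" and \<delta>: "0 < \<delta> \<and> \<delta> < 1"
  interpret link f \<alpha> using A by unfold_locales auto
  define R_max where "R_max = sqrt (real r ^ (d\<^sup>2 - d)) * \<alpha>"
  define R_M where "R_M = (real r * sqrt (real r)) ^ (d - 1) * \<alpha>"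
  let ?bound = "\<lambda>R. L_const f \<alpha> * R * sqrt (real d * real N / real m) + U_const f \<alpha> * sqrt (ln (4 / \<delta>) / real m)"
  have norms: "max_qnorm d N T \<le> R_max" "M_norm d N T \<le> R_M"
    using norm_bounds_of_rank[of N d \<alpha> T r] A by (auto simp: R_max_def R_M_def)
  have g: "c1 * c2 ^ d \<ge> 1" using grothendieck_constants_ge_1[OF assms] A by blast
  \<comment> \<open>Grothendieck's inequality puts the max-qnorm ball into an M-ball whose radius is
    larger by the factor \<open>c1 * c2 ^ d\<close>.\<close>
  have "K_max d N \<alpha> R_max \<subseteq> K_M d N \<alpha> (c1 * c2 ^ d * R_max)"
  proof
    fix X assume X: "X \<in> K_max d N \<alpha> R_max"
    then have "M_norm d N X \<le> c1 * c2 ^ d * max_qnorm d N X"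
      using assms A by (auto simp: grothendieck_constants_def K_max_def)
    also have "\<dots> \<le> c1 * c2 ^ d * R_max" using X g by (intro mult_left_mono) (auto simp: K_max_def)
    finally show "X \<in> K_M d N \<alpha> (c1 * c2 ^ d * R_max)" using X by (auto simp: K_max_def K_M_def)
  qed
  then have "measure_pmf.prob (observations m \<pi> f T)
      {(w, Y). \<forall>X. is_arg_min (neg_log_likelihood m f w Y) (\<lambda>X. X \<in> K_max d N \<alpha> R_max) X \<longrightarrow>
        (weighted_norm d N \<pi> (T - X))\<^sup>2 \<le> 48 * \<beta>_const f \<alpha> * ?bound (c1 * c2 ^ d * R_max)} \<ge> 1 - \<delta>"
    using A \<delta> norms by (intro recovery_bound) (auto simp: K_max_def)
  also have "measure_pmf.prob (observations m \<pi> f T)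
      {(w, Y). \<forall>X. is_arg_min (neg_log_likelihood m f w Y) (\<lambda>X. X \<in> K_max d N \<alpha> R_max) X \<longrightarrow>
        (weighted_norm d N \<pi> (T - X))\<^sup>2 \<le> 48 * \<beta>_const f \<alpha> * ?bound (c1 * c2 ^ d * R_max)} \<le>
    measure_pmf.prob (observations m \<pi> f T)
      {(w, Y). \<forall>X. is_arg_min (neg_log_likelihood m f w Y) (\<lambda>X. X \<in> K_max d N \<alpha> R_max) X \<longrightarrow>
        (weighted_norm d N \<pi> (T - X))\<^sup>2 \<le> 48 * c1 * c2 ^ d * \<beta>_const f \<alpha> * ?bound R_max}"
  proof -
    \<comment> \<open>The larger radius affects only the first summand; as the factor is at least 1,
      the nonnegative second summand may be multiplied by it as well.\<close>
    have "0 \<le> U_const f \<alpha> * sqrt (ln (4 / \<delta>) / real m)"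
      using U_pos \<delta> by (intro mult_nonneg_nonneg) (auto intro!: divide_nonneg_nonneg ln_ge_zero)
    then have "1 * (U_const f \<alpha> * sqrt (ln (4 / \<delta>) / real m)) \<le> c1 * c2 ^ d * (U_const f \<alpha> * sqrt (ln (4 / \<delta>) / real m))"
      by (intro mult_right_mono g)
    then have "?bound (c1 * c2 ^ d * R_max) \<le> c1 * c2 ^ d * ?bound R_max"
      by (simp add: algebra_simps)
    then have "48 * \<beta>_const f \<alpha> * ?bound (c1 * c2 ^ d * R_max) \<le> 48 * \<beta>_const f \<alpha> * (c1 * c2 ^ d * ?bound R_max)"
      using \<beta>_pos by (intro mult_left_mono) auto
    then have "48 * \<beta>_const f \<alpha> * ?bound (c1 * c2 ^ d * R_max) \<le> 48 * c1 * c2 ^ d * \<beta>_const f \<alpha> * ?bound R_max"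
      by (simp only: mult_ac)
    then show ?thesis by (intro measure_pmf.finite_measure_mono) (auto intro: order_trans)
  qed
  finally have part1: "measure_pmf.prob (observations m \<pi> f T)
      {(w, Y). \<forall>X. is_arg_min (neg_log_likelihood m f w Y) (\<lambda>X. X \<in> K_max d N \<alpha> R_max) X \<longrightarrow>
        (weighted_norm d N \<pi> (T - X))\<^sup>2 \<le> 48 * c1 * c2 ^ d * \<beta>_const f \<alpha> * ?bound R_max} \<ge> 1 - \<delta>" .
  have part2: "measure_pmf.prob (observations m \<pi> f T)
      {(w, Y). \<forall>X. is_arg_min (neg_log_likelihood m f w Y) (\<lambda>X. X \<in> K_M d N \<alpha> R_M) X \<longrightarrow>
        (weighted_norm d N \<pi> (T - X))\<^sup>2 \<le> 48 * \<beta>_const f \<alpha> * ?bound R_M} \<ge> 1 - \<delta>"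
    using A \<delta> norms by (intro recovery_bound) (auto simp: K_M_def)
  show "(let R_max = sqrt (real r ^ (d\<^sup>2 - d)) * \<alpha> in
           max_qnorm d N T \<le> R_max \<and>
           measure_pmf.prob (observations m \<pi> f T)
             {(\<omega>, Y). \<forall>X. is_arg_min (neg_log_likelihood m f \<omega> Y) (\<lambda>X. X \<in> K_max d N \<alpha> R_max) X \<longrightarrow>
                (weighted_norm d N \<pi> (T - X))\<^sup>2 \<le>
                  48 * c1 * c2 ^ d * \<beta>_const f \<alpha> *
                    (L_const f \<alpha> * R_max * sqrt (real d * real N / real m)
                     + U_const f \<alpha> * sqrt (ln (4 / \<delta>) / real m))}
             \<ge> 1 - \<delta>) \<and>
        (let R_M = (real r * sqrt (real r)) ^ (d - 1) * \<alpha> in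
           M_norm d N T \<le> R_M \<and>
           measure_pmf.prob (observations m \<pi> f T)
             {(\<omega>, Y). \<forall>X. is_arg_min (neg_log_likelihood m f \<omega> Y) (\<lambda>X. X \<in> K_M d N \<alpha> R_M) X \<longrightarrow>
                (weighted_norm d N \<pi> (T - X))\<^sup>2 \<le>
                  48 * \<beta>_const f \<alpha> *
                    (L_const f \<alpha> * R_M * sqrt (real d * real N / real m)
                     + U_const f \<alpha> * sqrt (ln (4 / \<delta>) / real m))}
             \<ge> 1 - \<delta>)"
    unfolding Let_def R_max_def[symmetric] R_M_def[symmetric] using norms part1 part2 by blast
qed

end
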